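(* Let $X\in 2^\omega$ be Schnorr random (with respect to Lebesgue measure $\lambda$). Then for every computable, minimal DDG-tree $S$, \[ \mathrm{OI}_{\Phi_S}(X)=\frac{1}{\mathit{AvgRT}(S)}. \]
   Context: $2^{<\omega}$ is the set of finite binary strings, $2^i$ the strings of length $i$, $2^\omega$ the infinite binary sequences, $\epsilon$ the empty string, $X\upharpoonright n$ the length-$n$ prefix of $X$, $X\upharpoonright[m,n)=X(m)\cdots X(n-1)$, $\llbracket V\rrbracket$ the set of sequences in $2^\omega$ having a prefix in $V\subseteq 2^{<\omega}$, and $\lambda$ is Lebesgue (uniform) measure on $2^\omega$. $X$ is Schnorr random if $X\notin\bigcap_i\mathcal U_i$ for every uniformly effectively open sequence $(\mathcal U_i)_{i\in\omega}$ with $\lambda(\mathcal U_i)\le2^{-i}$ and $\lambda(\mathcal U_i)$ computable uniformly in $i$. DDG-trees. A DDG-tree over a finite set $A=\{a_1,\dots,a_k\}$ is a tree $S\subseteq 2^{<\omega}$ with set of terminal nodes $D(S)$ and a labelling $\ell_S:D(S)\to A$ such that, setting $p_i=\sum_{\tau\in D(S),\,\ell_S(\tau)=a_i}2^{-|\tau|}$, one has $\sum_{i=1}^kp_i=1$. $S$ is computable if $D(S)$ is a computable set and $\ell_S$ is a computable function. Its average running time is $\mathit{AvgRT}(S)=\sum_{i\in\omega}i\cdot\lambda(\llbracket D(S)\cap 2^i\rrbracket)$ (with the convention $1/\infty=0$). The induced functional. Assume $\epsilon\notin D(S)$. Every $\sigma\in 2^{<\omega}$ can be written uniquely as $\sigma=\sigma_1{}^\frown\cdots{}^\frown\sigma_k$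 with $\sigma_1,\dots,\sigma_{k-1}\in D(S)$ and $\sigma_k$ (possibly empty) not extending any element of $D(S)$; set $\phi_S(\sigma)=\ell_S(\sigma_1)^\frown\cdots^\frown\ell_S(\sigma_{k-1})\in A^{<\omega}$. The functional $\Phi_S$ from $2^\omega$ to $A^\omega$ is $\Phi_S(X)=\bigcup_n\phi_S(X\upharpoonright n)$, which may be only a finite word (then $\Phi_S(X)$ is regarded as undefined); i.e. $\Phi_S(X)=\ell_S(X\upharpoonright n_0)^\frown\ell_S(X\upharpoonright[n_0,n_1))^\frown\cdots$, where $n_0$ is the unique $n$ with $X\upharpoonright n\in D(S)$ and $n_{k+1}$ is the unique $n$ with $X\upharpoonright[n_k,n)\in D(S)$. The canonical generator of $\Phi_S$ is the map sending $\sigma$ to the longest common initial segment of all members of $\{\Phi_S(X):\sigma\prec X\}$ (finite values included). $S$ is called minimal if $\phi_S$ is the canonical generator of $\Phi_S$. For minimal $S$, $\mathrm{OI}_{\Phi_S}(X)=\limsup_{n\to\infty}\frac{|\phi_S(X\upharpoonright n)|}{n}$, where $|\cdot|$ is length. *)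

theory Defs
  imports "HOL-Probability.Probability" "HOL-Library.Sublist"
begin

section \<open>Computability\<close>

text \<open>
  The total \<open>\<mu>\<close>-recursive functions of a given arity, with minimisation restricted to
  regular functions; this class is exactly the class of total computable functions.
  Arguments are passed as a list, and only the values on lists of length equal to the
  arity are meaningful.
\<close>

inductive total_recursive :: "nat \<Rightarrow> (nat list \<Rightarrow> nat) \<Rightarrow> bool" where
  zero: "total_recursive n (\<lambda>_. 0)"
| succ: "total_recursive 1 (\<lambda>xs. Suc (hd xs))"
| proj: "i < n \<Longrightarrow> total_recursive n (\<lambda>xs. xs ! i)"
| comp: "\<lbrakk>total_recursive (length gs) f; \<forall>g\<in>set gs. total_recursive n g\<rbrakk>
    \<Longrightarrow> total_recursive n (\<lambda>xs. f (map (\<lambda>g. g xs) gs))"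
| prim_rec: "\<lbrakk>total_recursive n f; total_recursive (Suc (Suc n)) h\<rbrakk>
    \<Longrightarrow> total_recursive (Suc n)
          (\<lambda>xs. rec_nat (f (tl xs)) (\<lambda>k r. h (k # r # tl xs)) (hd xs))"
| minim: "\<lbrakk>total_recursive (Suc n) f; \<forall>xs. length xs = n \<longrightarrow> (\<exists>y. f (y # xs) = 0)\<rbrakk>
    \<Longrightarrow> total_recursive n (\<lambda>xs. LEAST y. f (y # xs) = 0)"

text \<open>Bijective base-2 numeration identifies binary strings with natural numbers.\<close>

fun str_code :: "bool list \<Rightarrow> nat" where
  "str_code [] = 0"
| "str_code (b # \<sigma>) = 2 * str_code \<sigma> + (if b then 2 else 1)"

lemma bij_str_code: "bij str_code"
proof (rule bijI)
  have "str_code \<sigma> = str_code \<tau> \<Longrightarrow> \<sigma> = \<tau>" for \<sigma> \<tau>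
  proof (induction \<sigma> arbitrary: \<tau>)
    case Nil
    then show ?case by (cases \<tau>) (auto split: if_splits)
  next
    case (Cons b \<sigma>)
    then obtain c \<rho> where \<tau>: "\<tau> = c # \<rho>" by (cases \<tau>) (auto split: if_splits)
    have "b = c \<and> str_code \<sigma> = str_code \<rho>"
      using Cons.prems unfolding \<tau> by (cases b; cases c; simp; presburger)
    then show ?case using Cons.IH \<tau> by blast
  qed
  then show "inj str_code" by (rule injI)
  have "\<exists>\<sigma>. n = str_code \<sigma>" for n
  proof (induction n rule: less_induct)
    case (less n)
    show ?case
    proof (cases "n = 0")
      case True
      then show ?thesis by (intro exI[of _ "[]"]) simp
    next
      case False
      then have "(n - 1) div 2 < n" by linarith
      then obtain \<sigma> where \<sigma>: "(n - 1) div 2 = str_code \<sigma>" using less by blast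
      have "n = str_code (even n # \<sigma>)" using False \<sigma>[symmetric] by simp presburger
      then show ?thesis ..
    qed
  qed
  then show "surj str_code" by blast
qed

definition computable_set :: "bool list set \<Rightarrow> bool" where
  "computable_set V \<longleftrightarrow>
     (\<exists>f. total_recursive 1 f \<and> (\<forall>\<sigma>. f [str_code \<sigma>] = (if \<sigma> \<in> V then 1 else 0)))"

text \<open>
  A sequence of sets of strings that is uniformly computably enumerable: membership is the
  projection of a computable relation.
\<close>

definition uniformly_ce :: "(nat \<Rightarrow> bool list set) \<Rightarrow> bool" where
  "uniformly_ce W \<longleftrightarrow>
     (\<exists>f. total_recursive 3 f \<and> (\<forall>i. W i = {\<sigma>. \<exists>s. f [i, str_code \<sigma>, s] = 0}))"

text \<open>
  A uniformly computable sequence of reals: the rational \<open>(p - q) / (r + 1)\<close>, computed from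
  the index and the precision \<open>n\<close>, approximates the real up to \<open>2\<^sup>-\<^sup>n\<close>.
\<close>

definition uniformly_computable_real :: "(nat \<Rightarrow> real) \<Rightarrow> bool" where
  "uniformly_computable_real x \<longleftrightarrow>
     (\<exists>p q r. total_recursive 2 p \<and> total_recursive 2 q \<and> total_recursive 2 r \<and>
        (\<forall>i n. \<bar>x i - (real (p [i, n]) - real (q [i, n])) / real (Suc (r [i, n]))\<bar> \<le> (1/2) ^ n))"

section \<open>Cantor space and Schnorr randomness\<close>

definition segment :: "(nat \<Rightarrow> bool) \<Rightarrow> nat \<Rightarrow> bool list" where
  "segment X n = map X [0..<n]"

definition cyl :: "bool list set \<Rightarrow> (nat \<Rightarrow> bool) set" where
  "cyl V = {X. \<exists>n. segment X n \<in> V}"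

definition cantor :: "(nat \<Rightarrow> bool) measure" where
  "cantor = PiM UNIV (\<lambda>_. measure_pmf (bernoulli_pmf (1/2)))"

definition uniformly_effectively_open :: "(nat \<Rightarrow> (nat \<Rightarrow> bool) set) \<Rightarrow> bool" where
  "uniformly_effectively_open U \<longleftrightarrow> (\<exists>W. uniformly_ce W \<and> (\<forall>i. U i = cyl (W i)))"

definition schnorr_test :: "(nat \<Rightarrow> (nat \<Rightarrow> bool) set) \<Rightarrow> bool" where
  "schnorr_test U \<longleftrightarrow>
     uniformly_effectively_open U \<and>
     (\<forall>i. measure cantor (U i) \<le> (1/2) ^ i) \<and>
     uniformly_computable_real (\<lambda>i. measure cantor (U i))"

definition schnorr_random :: "(nat \<Rightarrow> bool) \<Rightarrow> bool" where
  "schnorr_random X \<longleftrightarrow> (\<forall>U. schnorr_test U \<longrightarrow> X \<notin> (\<Inter>i. U i))"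

section \<open>DDG-trees\<close>

definition is_tree :: "bool list set \<Rightarrow> bool" where
  "is_tree S \<longleftrightarrow> (\<forall>\<sigma>\<in>S. \<forall>\<tau>. prefix \<tau> \<sigma> \<longrightarrow> \<tau> \<in> S)"

definition terminal :: "bool list set \<Rightarrow> bool list set" where
  "terminal S = {\<sigma> \<in> S. \<forall>\<tau>\<in>S. \<not> strict_prefix \<sigma> \<tau>}"

text \<open>
  The terminal nodes form an antichain, so by Kraft's inequality the unordered sums below
  always converge.
\<close>

definition label_prob :: "bool list set \<Rightarrow> (bool list \<Rightarrow> 'a) \<Rightarrow> 'a \<Rightarrow> real" where
  "label_prob S l a = (\<Sum>\<^sub>\<infinity>\<tau> \<in> {\<tau> \<in> terminal S. l \<tau> = a}. (1/2) ^ length \<tau>)"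

text \<open>Only the values of the labelling \<open>l\<close> on terminal nodes are ever relevant.\<close>

definition ddg_tree :: "'a set \<Rightarrow> bool list set \<Rightarrow> (bool list \<Rightarrow> 'a) \<Rightarrow> bool" where
  "ddg_tree A S l \<longleftrightarrow>
     finite A \<and> is_tree S \<and> l ` terminal S \<subseteq> A \<and> (\<Sum>a\<in>A. label_prob S l a) = 1"

text \<open>
  The label set is given numerical codes by an injection \<open>c\<close>; since it is finite, the choice of
  \<open>c\<close> is immaterial. A partial computable function with computable domain is the same thing
  as the restriction of a total computable function to that domain.
\<close>

definition computable_ddg_tree :: "'a set \<Rightarrow> bool list set \<Rightarrow> (bool list \<Rightarrow> 'a) \<Rightarrow> bool" where
  "computable_ddg_tree A S l \<longleftrightarrow>
     computable_set (terminal S) \<and>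
     (\<exists>f c. total_recursive 1 f \<and> inj_on (c :: 'a \<Rightarrow> nat) A \<and>
        (\<forall>\<tau>\<in>terminal S. f [str_code \<tau>] = c (l \<tau>)))"

definition avg_rt :: "bool list set \<Rightarrow> ennreal" where
  "avg_rt S = (\<Sum>i. of_nat i * emeasure cantor (cyl (terminal S \<inter> {\<tau>. length \<tau> = i})))"

section \<open>The induced functional\<close>

definition parses :: "bool list set \<Rightarrow> bool list \<Rightarrow> bool list list \<Rightarrow> bool" where
  "parses S \<sigma> \<tau>s \<longleftrightarrow>
     set \<tau>s \<subseteq> terminal S \<and>
     (\<exists>\<rho>. \<sigma> = concat \<tau>s @ \<rho> \<and> (\<forall>\<tau>\<in>terminal S. \<not> prefix \<tau> \<rho>))"

definition phi :: "bool list set \<Rightarrow> (bool list \<Rightarrow> 'a) \<Rightarrow> bool list \<Rightarrow> 'a list" where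
  "phi S l \<sigma> = map l (THE \<tau>s. parses S \<sigma> \<tau>s)"

lemma terminal_prefix_eq:
  assumes "\<sigma> \<in> terminal S" "\<tau> \<in> terminal S" "prefix \<sigma> \<rho>" "prefix \<tau> \<rho>"
  shows "\<sigma> = \<tau>"
  using assms prefix_same_cases[of \<sigma> \<rho> \<tau>] unfolding terminal_def
  by (auto simp: strict_prefix_def)

lemma parses_exists:
  assumes "[] \<notin> terminal S"
  shows "\<exists>\<tau>s. parses S \<sigma> \<tau>s"
proof (induction \<sigma> rule: length_induct)
  case (1 \<sigma>)
  show ?case
  proof (cases "\<exists>\<tau>\<in>terminal S. prefix \<tau> \<sigma>")
    case True
    then obtain \<tau> \<rho> where \<tau>: "\<tau> \<in> terminal S" "\<sigma> = \<tau> @ \<rho>" by (auto elim: prefixE)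
    then have "length \<rho> < length \<sigma>" using assms by (cases \<tau>) auto
    then obtain \<tau>s where "parses S \<rho> \<tau>s" using 1 by blast
    then have "parses S \<sigma> (\<tau> # \<tau>s)" using \<tau> by (auto simp: parses_def)
    then show ?thesis ..
  next
    case False
    then have "parses S \<sigma> []" by (auto simp: parses_def)
    then show ?thesis ..
  qed
qed

lemma parses_unique: "parses S \<sigma> \<tau>s \<Longrightarrow> parses S \<sigma> \<tau>s' \<Longrightarrow> \<tau>s = \<tau>s'"
proof (induction \<tau>s arbitrary: \<sigma> \<tau>s')
  case Nil
  then show ?case by (cases \<tau>s') (auto simp: parses_def)
next
  case (Cons \<tau> \<tau>s)
  then obtain \<tau>' \<tau>s'' where \<tau>s': "\<tau>s' = \<tau>' # \<tau>s''"
    by (cases \<tau>s') (auto simp: parses_def)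
  have "\<exists>\<rho>. \<sigma> = \<tau> @ concat \<tau>s @ \<rho>" "\<exists>\<rho>. \<sigma> = \<tau>' @ concat \<tau>s'' @ \<rho>"
    using Cons.prems unfolding \<tau>s' parses_def by auto
  then have "prefix \<tau> \<sigma>" "prefix \<tau>' \<sigma>" unfolding prefix_def by blast+
  moreover have "\<tau> \<in> terminal S" "\<tau>' \<in> terminal S"
    using Cons.prems unfolding \<tau>s' parses_def by auto
  ultimately have eq: "\<tau>' = \<tau>" by (metis terminal_prefix_eq)
  have "parses S (drop (length \<tau>) \<sigma>) \<tau>s" using Cons.prems(1) by (auto simp: parses_def)
  moreover have "parses S (drop (length \<tau>) \<sigma>) \<tau>s''"
    using Cons.prems(2) unfolding \<tau>s' eq by (auto simp: parses_def)
  ultimately show ?case using Cons.IH \<tau>s' eq by blast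
qed

text \<open>
  Finite or infinite words are partial functions whose domain is an initial segment of the
  natural numbers; \<open>Phi S l X\<close> is the union, as partial functions, of the words
  \<open>phi S l (segment X n)\<close>, which extend one another (so the choice of \<open>n\<close> below is immaterial).
\<close>

definition Phi :: "bool list set \<Rightarrow> (bool list \<Rightarrow> 'a) \<Rightarrow> (nat \<Rightarrow> bool) \<Rightarrow> (nat \<Rightarrow> 'a option)" where
  "Phi S l X = (\<lambda>k. if \<exists>n. k < length (phi S l (segment X n))
     then Some (phi S l (segment X (LEAST n. k < length (phi S l (segment X n)))) ! k)
     else None)"

definition initial_segment :: "'a list \<Rightarrow> (nat \<Rightarrow> 'a option) \<Rightarrow> bool" where
  "initial_segment w Y \<longleftrightarrow> (\<forall>k<length w. Y k = Some (w ! k))"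

definition longest_common_initial_segment :: "'a list \<Rightarrow> (nat \<Rightarrow> 'a option) set \<Rightarrow> bool" where
  "longest_common_initial_segment w F \<longleftrightarrow>
     (\<forall>Y\<in>F. initial_segment w Y) \<and>
     (\<forall>v. (\<forall>Y\<in>F. initial_segment v Y) \<longrightarrow> length v \<le> length w)"

text \<open>
  If all values \<open>F X\<close> above some \<open>\<sigma>\<close> are one and the same infinite word, there is no longest
  finite common initial segment and no \<open>g\<close> with values in finite words satisfies the predicate.
\<close>

definition is_canonical_generator ::
    "(bool list \<Rightarrow> 'a list) \<Rightarrow> ((nat \<Rightarrow> bool) \<Rightarrow> (nat \<Rightarrow> 'a option)) \<Rightarrow> bool" where
  "is_canonical_generator g F \<longleftrightarrow>
     (\<forall>\<sigma>. longest_common_initial_segment (g \<sigma>) {F X | X. segment X (length \<sigma>) = \<sigma>})"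

definition minimal_ddg_tree :: "bool list set \<Rightarrow> (bool list \<Rightarrow> 'a) \<Rightarrow> bool" where
  "minimal_ddg_tree S l \<longleftrightarrow> is_canonical_generator (phi S l) (Phi S l)"

definition OI :: "bool list set \<Rightarrow> (bool list \<Rightarrow> 'a) \<Rightarrow> (nat \<Rightarrow> bool) \<Rightarrow> ennreal" where
  "OI S l X = limsup (\<lambda>n. ennreal (real (length (phi S l (segment X n))) / real n))"

end

theory Submission
  imports Defs
begin

text \<open>
  Cut the sequence \<open>X\<close> into blocks, each of which is a terminal node of \<open>S\<close>. For a random
  sequence the block lengths are independent with mean \<open>E = avg_rt S\<close>, possibly infinite, and
  \<open>length (phi S l (segment X n))\<close> is the number of blocks completed within the first \<open>n\<close> bits. By
  the law of large numbers for renewal processes this number is about \<open>n / E\<close>. The point is to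
  obtain this for a single Schnorr random sequence although neither \<open>E\<close> nor the rate of convergence
  in the law of large numbers needs to be computable.

  All probabilities concern strings of a fixed length, so they are counts divided by a power of
  two. Splitting off the first block gives a renewal equation (\<open>string_avg_first_block\<close>), from which
  everything else follows.

  For the upper bound, let \<open>t > 1 / E\<close> be rational. Some truncation of \<open>E\<close> still exceeds
  \<open>1 / t\<close>, which is enough for a Chernoff bound: the probability of at least
  \<open>t n\<close> blocks in \<open>n\<close> bits is at most \<open>r ^ n\<close> for some \<open>r < 1\<close> (\<open>exponential_upper_tail\<close>). Along a suitable
  arithmetic progression these decidable events form a Schnorr test, and monotonicity fills the gaps
  (\<open>limsup_ratio_le\<close>).

  For the lower bound, let \<open>t < 1 / E\<close> be rational. The mean number of blocks in \<open>n\<close> bits is at least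
  \<open>n / E - 1\<close> (\<open>avg_block_count_ge\<close>); together with the upper tail this forces the probability of
  fewer than \<open>t n\<close> blocks to tend to \<open>0\<close> (\<open>lower_tail_tendsto_0\<close>). No effective rate is available,
  but only a limit superior has to be bounded from below, so it suffices to avoid these events along
  one sequence of lengths, which is found by computable search (\<open>limsup_ratio_ge\<close>).

  In both cases the test is an instance of an effective Borel-Cantelli lemma
  (\<open>schnorr_random_finitely_often\<close>).
\<close>

section \<open>A calculus of computable functions\<close>

text \<open>
  The class \<open>total_recursive\<close> is sensitive to the values of a function on lists of the wrong
  length, which no computation ever sees. Quotienting these values away gives a notion that is
  invariant under pointwise equality, so that the closure rules below can be stated for
  arbitrary expressions in the argument list \<open>xs\<close> and applied by unification. A bound variable
  is pushed onto the front of that list: under a binder the new variable is \<open>hd ys\<close> and the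
  former arguments are \<open>tl ys\<close>.
\<close>
definition computable_fun :: "nat \<Rightarrow> (nat list \<Rightarrow> nat) \<Rightarrow> bool" where
  "computable_fun n F \<longleftrightarrow>
     (\<exists>f. total_recursive n f \<and> (\<forall>xs. length xs = n \<longrightarrow> f xs = F xs))"

abbreviation decidable_rel :: "nat \<Rightarrow> (nat list \<Rightarrow> bool) \<Rightarrow> bool" where
  "decidable_rel n P \<equiv> computable_fun n (\<lambda>xs. of_bool (P xs))"

lemma computable_fun_cong:
  "computable_fun n F \<Longrightarrow> (\<And>xs. length xs = n \<Longrightarrow> F xs = G xs) \<Longrightarrow> computable_fun n G"
  unfolding computable_fun_def by auto

lemma computable_fun_compose:
  assumes F: "computable_fun (length Gs) F" and Gs: "\<And>G. G \<in> set Gs \<Longrightarrow> computable_fun n G"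
  shows "computable_fun n (\<lambda>xs. F (map (\<lambda>G. G xs) Gs))"
proof -
  obtain f where f: "total_recursive (length Gs) f" "\<And>xs. length xs = length Gs \<Longrightarrow> f xs = F xs"
    using F unfolding computable_fun_def by blast
  obtain c where c: "\<And>G. G \<in> set Gs \<Longrightarrow> total_recursive n (c G)"
      "\<And>G xs. G \<in> set Gs \<Longrightarrow> length xs = n \<Longrightarrow> c G xs = G xs"
    using Gs unfolding computable_fun_def by metis
  have "total_recursive n (\<lambda>xs. f (map (\<lambda>g. g xs) (map c Gs)))"
    using f(1) c(1) by (intro total_recursive.comp) auto
  moreover have "f (map (\<lambda>g. g xs) (map c Gs)) = F (map (\<lambda>G. G xs) Gs)" if "length xs = n" for xs
  proof -
    have "map (\<lambda>g. g xs) (map c Gs) = map (\<lambda>G. G xs) Gs" using c(2) that by auto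
    then show ?thesis using f(2)[of "map (\<lambda>G. G xs) Gs"] by (simp only: length_map)
  qed
  ultimately show ?thesis unfolding computable_fun_def by blast
qed

lemma computable_fun_apply1:
  assumes "computable_fun 1 (\<lambda>xs. f (xs ! 0))" "computable_fun n a"
  shows "computable_fun n (\<lambda>xs. f (a xs))"
  using computable_fun_compose[of "[a]" "\<lambda>xs. f (xs ! 0)" n] assms by simp

lemma computable_fun_apply2:
  assumes "computable_fun 2 (\<lambda>xs. f (xs ! 0) (xs ! 1))" "computable_fun n a" "computable_fun n b"
  shows "computable_fun n (\<lambda>xs. f (a xs) (b xs))"
  using computable_fun_compose[of "[a, b]" "\<lambda>xs. f (xs ! 0) (xs ! 1)" n] assms
  by (auto simp: numeral_2_eq_2)

lemma computable_fun_nth: "i < n \<Longrightarrow> computable_fun n (\<lambda>xs. xs ! i)"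
  unfolding computable_fun_def using total_recursive.proj by blast

lemma computable_fun_hd: "0 < n \<Longrightarrow> computable_fun n (\<lambda>xs. hd xs)"
  by (rule computable_fun_cong[OF computable_fun_nth[of 0]]) (auto simp: hd_conv_nth)

lemma computable_fun_nth_tl: "Suc i < n \<Longrightarrow> computable_fun n (\<lambda>xs. tl xs ! i)"
  by (rule computable_fun_cong[OF computable_fun_nth[of "Suc i"]]) (auto simp: nth_tl)

lemma computable_fun_nth_tl_tl: "Suc (Suc i) < n \<Longrightarrow> computable_fun n (\<lambda>xs. tl (tl xs) ! i)"
  by (rule computable_fun_cong[OF computable_fun_nth[of "Suc (Suc i)"]]) (auto simp: nth_tl)

lemma computable_fun_hd_tl: "1 < n \<Longrightarrow> computable_fun n (\<lambda>xs. hd (tl xs))"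
proof (rule computable_fun_cong[OF computable_fun_nth_tl[of 0]])
  fix xs :: "nat list" assume "1 < n" "length xs = n"
  then have "tl xs \<noteq> []" by (cases xs) auto
  then show "tl xs ! 0 = hd (tl xs)" by (simp add: hd_conv_nth)
qed simp

lemma computable_fun_Suc: "computable_fun n F \<Longrightarrow> computable_fun n (\<lambda>xs. Suc (F xs))"
proof -
  have "computable_fun 1 (\<lambda>xs. Suc (xs ! 0))"
    unfolding computable_fun_def using total_recursive.succ
    by (intro exI[of _ "\<lambda>xs. Suc (hd xs)"]) (auto simp: length_Suc_conv)
  then show "computable_fun n F \<Longrightarrow> computable_fun n (\<lambda>xs. Suc (F xs))"
    by (rule computable_fun_apply1)
qed

lemma computable_fun_const: "computable_fun n (\<lambda>_. k)"
proof (induction k)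
  case 0
  then show ?case unfolding computable_fun_def using total_recursive.zero by blast
next
  case (Suc k)
  then show ?case by (rule computable_fun_Suc)
qed

lemma computable_fun_weaken:
  assumes "computable_fun n F"
  shows "computable_fun (Suc n) (\<lambda>ys. F (tl ys))"
proof -
  have "computable_fun (Suc n) (\<lambda>ys. F (map (\<lambda>G. G ys) (map (\<lambda>i ys. ys ! Suc i) [0..<n])))"
    using assms by (intro computable_fun_compose) (auto intro: computable_fun_nth)
  then show ?thesis
  proof (rule computable_fun_cong)
    fix ys :: "nat list" assume "length ys = Suc n"
    then have "map (\<lambda>G. G ys) (map (\<lambda>i ys. ys ! Suc i) [0..<n]) = tl ys"
      by (intro nth_equalityI) (auto simp: nth_tl)
    then show "F (map (\<lambda>G. G ys) (map (\<lambda>i ys. ys ! Suc i) [0..<n])) = F (tl ys)" by simp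
  qed
qed

lemma computable_fun_substitute:
  assumes "computable_fun (Suc n) G" "computable_fun n E"
  shows "computable_fun n (\<lambda>xs. G (E xs # xs))"
proof -
  have "computable_fun n (\<lambda>xs. G (map (\<lambda>G. G xs) (E # map (\<lambda>i xs. xs ! i) [0..<n])))"
    using assms by (intro computable_fun_compose) (auto intro: computable_fun_nth)
  then show ?thesis
  proof (rule computable_fun_cong)
    fix xs :: "nat list" assume "length xs = n"
    then have "map (\<lambda>G. G xs) (map (\<lambda>i xs. xs ! i) [0..<n]) = xs"
      by (intro nth_equalityI) auto
    then show "G (map (\<lambda>G. G xs) (E # map (\<lambda>i xs. xs ! i) [0..<n])) = G (E xs # xs)" by simp
  qed
qed

lemma computable_fun_rec:
  assumes F: "computable_fun n F"
    and H: "computable_fun (Suc (Suc n)) (\<lambda>zs. H (hd zs) (hd (tl zs)) (tl (tl zs)))"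
    and E: "computable_fun n E"
  shows "computable_fun n (\<lambda>xs. rec_nat (F xs) (\<lambda>k r. H k r xs) (E xs))"
proof -
  obtain f where f: "total_recursive n f" "\<And>xs. length xs = n \<Longrightarrow> f xs = F xs"
    using F unfolding computable_fun_def by blast
  obtain h where h: "total_recursive (Suc (Suc n)) h"
      "\<And>zs. length zs = Suc (Suc n) \<Longrightarrow> h zs = H (hd zs) (hd (tl zs)) (tl (tl zs))"
    using H unfolding computable_fun_def by blast
  have "computable_fun (Suc n) (\<lambda>ys. rec_nat (F (tl ys)) (\<lambda>k r. H k r (tl ys)) (hd ys))"
    unfolding computable_fun_def
    using total_recursive.prim_rec[OF f(1) h(1)] f(2) h(2)
    by (intro exI[of _ "\<lambda>xs. rec_nat (f (tl xs)) (\<lambda>k r. h (k # r # tl xs)) (hd xs)"]) auto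
  from computable_fun_substitute[OF this E] show ?thesis by simp
qed

lemma computable_fun_add:
  assumes "computable_fun n a" "computable_fun n b"
  shows "computable_fun n (\<lambda>xs. a xs + b xs)"
proof -
  have "rec_nat x (\<lambda>k r. Suc r) y = x + y" for x y :: nat by (induction y) auto
  moreover have "computable_fun n (\<lambda>xs. rec_nat (a xs) (\<lambda>k r. Suc r) (b xs))"
    by (intro computable_fun_rec computable_fun_Suc computable_fun_hd_tl assms) simp
  ultimately show ?thesis by simp
qed

lemma computable_fun_mult:
  assumes "computable_fun n a" "computable_fun n b"
  shows "computable_fun n (\<lambda>xs. a xs * b xs)"
proof -
  have "rec_nat 0 (\<lambda>k r. r + x) y = x * y" for x y :: nat by (induction y) auto
  moreover have "computable_fun n (\<lambda>xs. rec_nat 0 (\<lambda>k r. r + a xs) (b xs))"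
    by (intro computable_fun_rec computable_fun_add computable_fun_hd_tl computable_fun_const
        computable_fun_weaken assms) simp
  ultimately show ?thesis by simp
qed

lemma computable_fun_diff:
  assumes "computable_fun n a" "computable_fun n b"
  shows "computable_fun n (\<lambda>xs. a xs - b xs)"
proof -
  have pred: "rec_nat 0 (\<lambda>k r. k) y = y - 1" for y :: nat by (cases y) auto
  have "computable_fun 1 (\<lambda>xs. rec_nat 0 (\<lambda>k r. k) (xs ! 0))"
    by (intro computable_fun_rec computable_fun_const computable_fun_hd computable_fun_nth) auto
  then have *: "computable_fun m (\<lambda>xs. e xs - 1)" if "computable_fun m e" for m e
    using computable_fun_apply1[of "\<lambda>y. y - 1", OF _ that] by (simp add: pred)
  have "rec_nat x (\<lambda>k r. r - 1) y = x - y" for x y :: nat by (induction y) auto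
  moreover have "computable_fun n (\<lambda>xs. rec_nat (a xs) (\<lambda>k r. r - 1) (b xs))"
    by (intro computable_fun_rec * computable_fun_hd_tl assms) simp
  ultimately show ?thesis by simp
qed

lemma computable_fun_power:
  assumes "computable_fun n a" "computable_fun n b"
  shows "computable_fun n (\<lambda>xs. a xs ^ b xs)"
proof -
  have "rec_nat 1 (\<lambda>k r. r * x) y = x ^ y" for x y :: nat by (induction y) auto
  moreover have "computable_fun n (\<lambda>xs. rec_nat 1 (\<lambda>k r. r * a xs) (b xs))"
    by (intro computable_fun_rec computable_fun_mult computable_fun_hd_tl computable_fun_const
        computable_fun_weaken assms) simp
  ultimately show ?thesis by simp
qed

lemma computable_fun_sum:
  assumes "computable_fun n e" "computable_fun (Suc n) (\<lambda>ys. B (hd ys) (tl ys))"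
  shows "computable_fun n (\<lambda>xs. \<Sum>k<e xs. B k xs)"
proof -
  have *: "rec_nat 0 (\<lambda>k r. r + b k) y = (\<Sum>k<y. b k)" for b :: "nat \<Rightarrow> nat" and y
    by (induction y) auto
  have "computable_fun (Suc (Suc n)) (\<lambda>zs. B (hd zs) (tl (tl zs)))"
  proof -
    have "computable_fun (Suc (Suc n))
      (\<lambda>zs. (\<lambda>ys. B (hd ys) (tl ys)) (map (\<lambda>G. G zs) (hd # map (\<lambda>i zs. zs ! Suc (Suc i)) [0..<n])))"
      using assms(2)
      by (intro computable_fun_compose) (auto intro: computable_fun_nth computable_fun_hd)
    then show ?thesis
    proof (rule computable_fun_cong)
      fix zs :: "nat list" assume "length zs = Suc (Suc n)"
      then have "map (\<lambda>G. G zs) (map (\<lambda>i zs. zs ! Suc (Suc i)) [0..<n]) = tl (tl zs)"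
        by (intro nth_equalityI) (auto simp: nth_tl)
      then show "(\<lambda>ys. B (hd ys) (tl ys))
           (map (\<lambda>G. G zs) (hd # map (\<lambda>i zs. zs ! Suc (Suc i)) [0..<n])) = B (hd zs) (tl (tl zs))"
        by simp
    qed
  qed
  then have "computable_fun n (\<lambda>xs. rec_nat 0 (\<lambda>k r. r + B k xs) (e xs))"
    by (intro computable_fun_rec computable_fun_add computable_fun_hd_tl computable_fun_const
        assms(1)) auto
  then show ?thesis by (simp add: *)
qed

lemma decidable_rel_le:
  assumes "computable_fun n a" "computable_fun n b"
  shows "decidable_rel n (\<lambda>xs. a xs \<le> b xs)"
  by (rule computable_fun_cong[of n "\<lambda>xs. 1 - (a xs - b xs)"])
     (auto intro!: computable_fun_diff computable_fun_const assms)

lemma decidable_rel_less: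
  assumes "computable_fun n a" "computable_fun n b"
  shows "decidable_rel n (\<lambda>xs. a xs < b xs)"
  using decidable_rel_le[OF computable_fun_Suc[OF assms(1)] assms(2)] by (simp add: Suc_le_eq)

lemma decidable_rel_conj:
  assumes "decidable_rel n P" "decidable_rel n Q"
  shows "decidable_rel n (\<lambda>xs. P xs \<and> Q xs)"
  using computable_fun_mult[OF assms] by (simp add: of_bool_conj)

lemma decidable_rel_not:
  assumes "decidable_rel n P"
  shows "decidable_rel n (\<lambda>xs. \<not> P xs)"
  by (rule computable_fun_cong[OF computable_fun_diff[OF computable_fun_const[of n 1] assms]]) auto

lemma decidable_rel_eq:
  assumes "computable_fun n a" "computable_fun n b"
  shows "decidable_rel n (\<lambda>xs. a xs = b xs)"
  using decidable_rel_conj[OF decidable_rel_le[OF assms] decidable_rel_le[OF assms(2,1)]]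
  by (simp add: eq_iff)

lemma decidable_rel_ex:
  assumes "computable_fun n e" "decidable_rel (Suc n) (\<lambda>ys. P (hd ys) (tl ys))"
  shows "decidable_rel n (\<lambda>xs. \<exists>k<e xs. P k xs)"
proof -
  have "decidable_rel n (\<lambda>xs. 0 < (\<Sum>k<e xs. of_bool (P k xs) :: nat))"
    by (intro decidable_rel_less computable_fun_const computable_fun_sum assms)
  moreover have "0 < (\<Sum>k<e xs. of_bool (P k xs) :: nat) \<longleftrightarrow> (\<exists>k<e xs. P k xs)" for xs
    by (simp add: neq0_conv[symmetric] del: neq0_conv) blast
  ultimately show ?thesis by simp
qed

lemma computable_fun_if:
  assumes "decidable_rel n P" "computable_fun n a" "computable_fun n b"
  shows "computable_fun n (\<lambda>xs. if P xs then a xs else b xs)"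
proof -
  have "computable_fun n (\<lambda>xs. of_bool (P xs) * a xs + of_bool (\<not> P xs) * b xs)"
    by (intro computable_fun_add computable_fun_mult decidable_rel_not assms)
  then show ?thesis by (rule computable_fun_cong) auto
qed

lemma computable_fun_Least:
  assumes P: "decidable_rel (Suc n) (\<lambda>ys. P (hd ys) (tl ys))"
    and ex: "\<And>xs. length xs = n \<Longrightarrow> \<exists>y. P y xs"
  shows "computable_fun n (\<lambda>xs. LEAST y. P y xs)"
proof -
  have "decidable_rel (Suc n) (\<lambda>ys. \<not> P (hd ys) (tl ys))" by (rule decidable_rel_not[OF P])
  then obtain f where f: "total_recursive (Suc n) f"
      "\<And>ys. length ys = Suc n \<Longrightarrow> f ys = of_bool (\<not> P (hd ys) (tl ys))"
    unfolding computable_fun_def by blast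
  have zero: "f (y # xs) = 0 \<longleftrightarrow> P y xs" if "length xs = n" for y xs
    using f(2) that by simp
  then have "total_recursive n (\<lambda>xs. LEAST y. f (y # xs) = 0)"
    using ex by (intro total_recursive.minim f(1)) auto
  then show ?thesis unfolding computable_fun_def using zero by force
qed

text \<open>
  The quotient is found by unbounded search; testing \<open>0 < y\<close> makes the search stop at
  \<open>0\<close> for a zero divisor, in agreement with \<open>x div 0 = 0\<close>.
\<close>
lemma computable_fun_div:
  assumes "computable_fun n a" "computable_fun n b"
  shows "computable_fun n (\<lambda>xs. a xs div b xs)"
proof -
  define q where "q x y = (LEAST k::nat. \<not> (0 < y \<and> Suc k * y \<le> x))" for x y :: nat
  have ex: "\<exists>k. \<not> (0 < y \<and> Suc k * y \<le> x)" for x y :: nat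
    by (rule exI[of _ x]) (cases y; simp)
  have "computable_fun 2 (\<lambda>xs. q (xs ! 0) (xs ! 1))"
    unfolding q_def
    by (intro computable_fun_Least decidable_rel_not decidable_rel_conj decidable_rel_less
        decidable_rel_le computable_fun_mult computable_fun_Suc computable_fun_hd
        computable_fun_nth_tl computable_fun_const ex) auto
  moreover have "q x y = x div y" for x y
    unfolding q_def
  proof (rule Least_equality)
    show "\<not> (0 < y \<and> Suc (x div y) * y \<le> x)"
      by (metis Suc_n_not_le_n less_eq_div_iff_mult_less_eq)
    show "x div y \<le> k" if "\<not> (0 < y \<and> Suc k * y \<le> x)" for k
      using that by (metis div_by_0 le0 less_eq_div_iff_mult_less_eq neq0_conv not_less_eq_eq)
  qed
  ultimately have "computable_fun 2 (\<lambda>xs. xs ! 0 div xs ! 1)" by simp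
  from computable_fun_apply2[OF this assms] show ?thesis .
qed

lemma computable_fun_mod:
  assumes "computable_fun n a" "computable_fun n b"
  shows "computable_fun n (\<lambda>xs. a xs mod b xs)"
  unfolding minus_mult_div_eq_mod[symmetric]
  by (intro computable_fun_diff computable_fun_mult computable_fun_div assms)

lemmas computability_rules =
  computable_fun_nth computable_fun_hd computable_fun_nth_tl computable_fun_nth_tl_tl
  computable_fun_hd_tl computable_fun_const computable_fun_Suc computable_fun_add
  computable_fun_mult computable_fun_diff computable_fun_power computable_fun_sum
  computable_fun_div computable_fun_mod computable_fun_if
  decidable_rel_le decidable_rel_less decidable_rel_eq decidable_rel_conj decidable_rel_not
  decidable_rel_ex

section \<open>Computing with binary strings\<close>

text \<open>
  The number \<open>Suc (str_code \<sigma>)\<close> has the binary expansion given by \<open>\<sigma>\<close>, least significant digit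
  first, followed by a leading \<open>1\<close>. Hence the length of a string, its prefixes and its suffixes
  correspond to logarithm, remainder and quotient by powers of two.
\<close>
lemma Suc_str_code_bounds:
  "2 ^ length \<sigma> \<le> Suc (str_code \<sigma>) \<and> Suc (str_code \<sigma>) < 2 ^ Suc (length \<sigma>)"
  by (induction \<sigma>) auto

lemma length_eq_Least_code: "length \<sigma> = (LEAST L. Suc (str_code \<sigma>) < 2 ^ Suc L)"
proof (rule Least_equality[symmetric])
  show "Suc (str_code \<sigma>) < 2 ^ Suc (length \<sigma>)" using Suc_str_code_bounds by blast
  show "length \<sigma> \<le> L" if "Suc (str_code \<sigma>) < 2 ^ Suc L" for L
  proof -
    have "(2::nat) ^ length \<sigma> < 2 ^ Suc L" using that Suc_str_code_bounds[of \<sigma>] by linarith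
    then show ?thesis by (simp only: power_strict_increasing_iff[of "2::nat"] less_Suc_eq_le)
  qed
qed

lemma Suc_str_code_Cons: "Suc (str_code (b # \<sigma>)) = of_bool b + 2 * Suc (str_code \<sigma>)"
  by simp

lemma str_code_take:
  "p \<le> length \<sigma> \<Longrightarrow> Suc (str_code (take p \<sigma>)) = 2 ^ p + Suc (str_code \<sigma>) mod 2 ^ p"
proof (induction p arbitrary: \<sigma>)
  case 0
  then show ?case by simp
next
  case (Suc p)
  then obtain b \<rho> where \<sigma>: "\<sigma> = b # \<rho>" by (cases \<sigma>) auto
  have mod: "(of_bool b + 2 * x) mod (2 * 2 ^ p) = of_bool b + 2 * (x mod 2 ^ p)" for x :: nat
    using mod_mult2_eq[of "of_bool b + 2 * x" 2 "2 ^ p"] by simp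
  have "Suc (str_code (take p \<rho>)) = 2 ^ p + Suc (str_code \<rho>) mod 2 ^ p"
    using Suc \<sigma> by simp
  then show ?case unfolding \<sigma> take_Suc_Cons Suc_str_code_Cons power_Suc mod by simp
qed

lemma str_code_drop:
  "s \<le> length \<sigma> \<Longrightarrow> Suc (str_code (drop s \<sigma>)) = Suc (str_code \<sigma>) div 2 ^ s"
proof (induction s arbitrary: \<sigma>)
  case 0
  then show ?case by simp
next
  case (Suc s)
  then obtain b \<rho> where \<sigma>: "\<sigma> = b # \<rho>" by (cases \<sigma>) auto
  have div: "(of_bool b + 2 * x) div (2 * 2 ^ s) = x div 2 ^ s" for x :: nat
    using div_mult2_eq[of "of_bool b + 2 * x" 2 "2 ^ s"] by simp
  have "Suc (str_code (drop s \<rho>)) = Suc (str_code \<rho>) div 2 ^ s" using Suc \<sigma> by simp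
  then show ?case unfolding \<sigma> drop_Suc_Cons Suc_str_code_Cons power_Suc div by simp
qed

abbreviation computable_str :: "nat \<Rightarrow> (nat list \<Rightarrow> bool list) \<Rightarrow> bool" where
  "computable_str n s \<equiv> computable_fun n (\<lambda>xs. str_code (s xs))"

definition decode :: "nat \<Rightarrow> bool list" where
  "decode = inv str_code"

lemma str_code_decode [simp]: "str_code (decode c) = c"
  unfolding decode_def using bij_str_code by (meson bij_inv_eq_iff)

lemma decode_str_code [simp]: "decode (str_code \<sigma>) = \<sigma>"
  unfolding decode_def using bij_str_code by (simp add: bij_is_inj)

lemma computable_str_decode: "computable_fun n a \<Longrightarrow> computable_str n (\<lambda>xs. decode (a xs))"
  by simp

lemma computable_fun_length:
  assumes "computable_str n s"
  shows "computable_fun n (\<lambda>xs. length (s xs))"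
proof -
  have "computable_fun 1 (\<lambda>xs. LEAST L. Suc (xs ! 0) < 2 ^ Suc L)"
  proof (intro computable_fun_Least computability_rules)
    fix xs :: "nat list"
    show "\<exists>L. Suc (xs ! 0) < 2 ^ Suc L"
      using Suc_str_code_bounds[of "decode (xs ! 0)"] by auto
  qed auto
  from computable_fun_apply1[OF this assms] show ?thesis by (simp only: length_eq_Least_code)
qed

lemma computable_fun_min:
  assumes "computable_fun n a" "computable_fun n b"
  shows "computable_fun n (\<lambda>xs. min (a xs) (b xs))"
  unfolding min_def by (intro computability_rules assms)

lemma computable_str_take:
  assumes "computable_fun n p" "computable_str n s"
  shows "computable_str n (\<lambda>xs. take (p xs) (s xs))"
proof (rule computable_fun_cong)
  fix xs
  have "Suc (str_code (take (p xs) (s xs))) = 2 ^ min (p xs) (length (s xs)) +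
          Suc (str_code (s xs)) mod 2 ^ min (p xs) (length (s xs))"
    using str_code_take[of "p xs" "s xs"] str_code_take[of "length (s xs)" "s xs"]
    by (cases "p xs \<le> length (s xs)") (simp_all add: min_def del: str_code.simps)
  then show "2 ^ min (p xs) (length (s xs)) +
          Suc (str_code (s xs)) mod 2 ^ min (p xs) (length (s xs)) - 1 =
          str_code (take (p xs) (s xs))" by simp
qed (intro computability_rules computable_fun_min computable_fun_length assms)

lemma computable_str_drop:
  assumes "computable_fun n p" "computable_str n s"
  shows "computable_str n (\<lambda>xs. drop (p xs) (s xs))"
proof (rule computable_fun_cong)
  fix xs
  have "Suc (str_code (drop (p xs) (s xs))) =
          Suc (str_code (s xs)) div 2 ^ min (p xs) (length (s xs))"
    using str_code_drop[of "p xs" "s xs"] str_code_drop[of "length (s xs)" "s xs"]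
    by (cases "p xs \<le> length (s xs)") (simp_all add: min_def del: str_code.simps)
  then show "Suc (str_code (s xs)) div 2 ^ min (p xs) (length (s xs)) - 1 =
          str_code (drop (p xs) (s xs))" by simp
qed (intro computability_rules computable_fun_min computable_fun_length assms)

lemma decidable_rel_mem:
  assumes "computable_set R" "computable_str n s"
  shows "decidable_rel n (\<lambda>xs. s xs \<in> R)"
proof -
  obtain f where f: "total_recursive 1 f" "\<And>\<sigma>. f [str_code \<sigma>] = (if \<sigma> \<in> R then 1 else 0)"
    using assms(1) unfolding computable_set_def by blast
  have "f xs = of_bool (decode (xs ! 0) \<in> R)" if "length xs = 1" for xs
    using that f(2)[of "decode (xs ! 0)"] by (auto simp: length_Suc_conv)
  then have "decidable_rel 1 (\<lambda>xs. decode (xs ! 0) \<in> R)"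
    unfolding computable_fun_def using f(1) by blast
  from computable_fun_apply1[OF this assms(2)] show ?thesis by simp
qed

lemma computable_setI:
  assumes "decidable_rel 1 (\<lambda>xs. decode (xs ! 0) \<in> R)"
  shows "computable_set R"
proof -
  obtain f where f: "total_recursive 1 f" "\<And>xs. length xs = 1 \<Longrightarrow> f xs = of_bool (decode (xs ! 0) \<in> R)"
    using assms unfolding computable_fun_def by blast
  show ?thesis unfolding computable_set_def
    by (rule exI[of _ f]) (use f in \<open>auto simp: of_bool_def\<close>)
qed

lemma finite_length_eq [simp]: "finite {\<sigma> :: bool list. length \<sigma> = n \<and> P \<sigma>}"
  using finite_lists_length_eq[of "UNIV :: bool set" n] by (auto elim: rev_finite_subset)

text \<open>
  Strings of length \<open>m\<close> have codes below \<open>2 ^ Suc m\<close>, so counting them is a bounded sum.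
\<close>
lemma computable_fun_card_strings:
  assumes e: "computable_fun n e"
    and P: "decidable_rel (Suc n) (\<lambda>ys. P (decode (hd ys)) (tl ys))"
  shows "computable_fun n (\<lambda>xs. card {\<sigma>. length \<sigma> = e xs \<and> P \<sigma> xs})"
proof (rule computable_fun_cong)
  show "computable_fun n
      (\<lambda>xs. \<Sum>c<2 ^ Suc (e xs). of_bool (length (decode c) = e xs \<and> P (decode c) xs))"
    by (intro computability_rules computable_fun_length computable_str_decode
        computable_fun_weaken e P) auto
  fix xs
  let ?A = "{\<sigma>. length \<sigma> = e xs \<and> P \<sigma> xs}"
  let ?B = "{c. c < 2 ^ Suc (e xs) \<and> length (decode c) = e xs \<and> P (decode c) xs}"
  have "str_code ` ?A = ?B"
  proof (intro equalityI subsetI)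
    fix c assume "c \<in> str_code ` ?A"
    then obtain \<sigma> where "c = str_code \<sigma>" "\<sigma> \<in> ?A" by blast
    then show "c \<in> ?B" using Suc_str_code_bounds[of \<sigma>] by simp
  next
    fix c assume "c \<in> ?B"
    then show "c \<in> str_code ` ?A" by (intro image_eqI[of _ _ "decode c"]) auto
  qed
  then have "card ?A = card ?B"
    using card_image[of str_code ?A] bij_str_code by (metis bij_is_inj inj_on_subset subset_UNIV)
  also have "\<dots> = (\<Sum>c<2 ^ Suc (e xs). of_bool (length (decode c) = e xs \<and> P (decode c) xs))"
    by (subst sum_of_bool_eq) (auto intro!: arg_cong[where f = card])
  finally show "(\<Sum>c<2 ^ Suc (e xs). of_bool (length (decode c) = e xs \<and> P (decode c) xs)) = card ?A"
    by simp
qed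

section \<open>Schnorr tests from decidable sets of strings\<close>
lemma length_segment [simp]: "length (segment X n) = n"
  by (simp add: segment_def)

lemma take_segment: "m \<le> n \<Longrightarrow> take m (segment X n) = segment X m"
  by (simp add: segment_def take_map)

definition string_prob :: "nat \<Rightarrow> (bool list \<Rightarrow> bool) \<Rightarrow> real" where
  "string_prob n P = card {\<sigma>. length \<sigma> = n \<and> P \<sigma>} / 2 ^ n"

interpretation coin: prob_space "measure_pmf (bernoulli_pmf (1/2))"
  by (rule measure_pmf.prob_space_axioms)

interpretation coins: product_prob_space "\<lambda>_. measure_pmf (bernoulli_pmf (1/2))" "UNIV :: nat set"
  by unfold_locales

interpretation cantor: prob_space cantor
  unfolding cantor_def by (rule coins.prob_space_axioms)

lemma space_cantor [simp]: "space cantor = UNIV"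
  by (simp add: cantor_def space_PiM)

lemma
  assumes n: "length \<sigma> = n"
  shows sets_segment_eq: "{X. segment X n = \<sigma>} \<in> sets cantor"
    and measure_segment_eq: "measure cantor {X. segment X n = \<sigma>} = (1/2) ^ n"
proof -
  let ?M = "\<lambda>_::nat. measure_pmf (bernoulli_pmf (1/2))"
  let ?E = "prod_emb UNIV ?M {..<n} (\<Pi>\<^sub>E i\<in>{..<n}. {\<sigma> ! i})"
  have "segment X n = \<sigma> \<longleftrightarrow> (\<forall>i<n. X i = \<sigma> ! i)" for X
    unfolding segment_def list_eq_iff_nth_eq using n by simp
  then have eq: "{X. segment X n = \<sigma>} = ?E"
    by (auto simp: prod_emb_def PiE_iff space_PiM restrict_def)
  show "{X. segment X n = \<sigma>} \<in> sets cantor"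
    unfolding eq cantor_def by (intro sets_PiM_I) auto
  have "measure cantor ?E = (\<Prod>i<n. measure (measure_pmf (bernoulli_pmf (1/2))) {\<sigma> ! i})"
    unfolding cantor_def by (rule coins.measure_PiM_emb) auto
  also have "\<dots> = (\<Prod>i<n. 1/2)"
    by (intro prod.cong refl) (auto simp: measure_pmf_single)
  finally show "measure cantor {X. segment X n = \<sigma>} = (1/2) ^ n"
    unfolding eq by simp
qed

lemma
  shows sets_segment: "{X. P (segment X n)} \<in> sets cantor"
    and measure_segment: "measure cantor {X. P (segment X n)} = string_prob n P"
proof -
  let ?A = "{\<sigma>. length \<sigma> = n \<and> P \<sigma>}"
  let ?C = "\<lambda>\<sigma>. {X. segment X n = \<sigma>}"
  have eq: "{X. P (segment X n)} = (\<Union>\<sigma>\<in>?A. ?C \<sigma>)" by auto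
  show "{X. P (segment X n)} \<in> sets cantor"
    unfolding eq using sets_segment_eq by (intro sets.finite_UN) auto
  have "measure cantor (\<Union>\<sigma>\<in>?A. ?C \<sigma>) = (\<Sum>\<sigma>\<in>?A. measure cantor (?C \<sigma>))"
    by (rule cantor.finite_measure_finite_Union)
       (auto simp: sets_segment_eq disjoint_family_on_def)
  also have "\<dots> = (\<Sum>\<sigma>\<in>?A. (1/2) ^ n)"
    by (intro sum.cong refl) (auto simp: measure_segment_eq)
  finally show "measure cantor {X. P (segment X n)} = string_prob n P"
    unfolding eq string_prob_def by (simp add: power_divide)
qed

lemma computable_fun_2_witness:
  assumes "computable_fun 2 (\<lambda>xs. p (xs ! 0) (xs ! 1))"
  shows "\<exists>f. total_recursive 2 f \<and> (\<forall>i n. f [i, n] = p i n)"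
proof -
  obtain f where f: "total_recursive 2 f" "\<And>xs. length xs = 2 \<Longrightarrow> f xs = p (xs ! 0) (xs ! 1)"
    using assms unfolding computable_fun_def by blast
  show ?thesis by (intro exI[of _ f]) (use f in simp)
qed

lemma uniformly_ceI:
  assumes "decidable_rel 3 (\<lambda>xs. P (xs ! 0) (decode (xs ! 1)) (xs ! 2))"
    and "\<And>i. W i = {\<sigma>. \<exists>s. P i \<sigma> s}"
  shows "uniformly_ce W"
proof -
  from decidable_rel_not[OF assms(1)] obtain f where f: "total_recursive 3 f"
    "\<And>xs. length xs = 3 \<Longrightarrow> f xs = of_bool (\<not> P (xs ! 0) (decode (xs ! 1)) (xs ! 2))"
    unfolding computable_fun_def by blast
  have "f [i, str_code \<sigma>, s] = 0 \<longleftrightarrow> P i \<sigma> s" for i \<sigma> s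
    using f(2)[of "[i, str_code \<sigma>, s]"] by (simp add: numeral_2_eq_2)
  then show ?thesis unfolding uniformly_ce_def assms(2) using f(1) by (intro exI[of _ f]) simp
qed

text \<open>
  All the approximations needed are dyadic: probabilities of events that depend on finitely many
  coin tosses.
\<close>
lemma uniformly_computable_realI:
  assumes p: "computable_fun 2 (\<lambda>xs. p (xs ! 0) (xs ! 1))"
    and L: "computable_fun 2 (\<lambda>xs. L (xs ! 0) (xs ! 1))"
    and approx: "\<And>i n. \<bar>x i - real (p i n) / 2 ^ L i n\<bar> \<le> (1/2) ^ n"
  shows "uniformly_computable_real x"
proof -
  obtain f where f: "total_recursive 2 f" "\<And>i n. f [i, n] = p i n"
    using computable_fun_2_witness[OF p] by blast
  have "computable_fun 2 (\<lambda>xs. 2 ^ L (xs ! 0) (xs ! 1) - 1)"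
    by (intro computability_rules L)
  then obtain r where r: "total_recursive 2 r" "\<And>i n. r [i, n] = 2 ^ L i n - 1"
    using computable_fun_2_witness[of "\<lambda>i n. 2 ^ L i n - 1"] by blast
  have "real (Suc (r [i, n])) = 2 ^ L i n" for i n
    unfolding r(2) by (simp add: Suc_diff_le)
  then show ?thesis
    unfolding uniformly_computable_real_def using f r(1) approx total_recursive.zero[of 2]
    by (intro exI[of _ f] exI[of _ "\<lambda>_. 0"] exI[of _ r]) simp
qed

lemma sums_half_powers_tail: "(\<lambda>j. (1/2::real) ^ (j + Suc n)) sums (1/2) ^ n"
  using sums_mult2[OF geometric_sums[of "1/2::real"], of "(1/2) ^ Suc n"]
  by (simp add: power_add mult_ac)

lemma measure_tail_events_le:
  fixes E :: "nat \<Rightarrow> (nat \<Rightarrow> bool) set"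
  assumes "\<And>j. E j \<in> sets cantor" "\<And>j. measure cantor (E j) \<le> (1/2) ^ j"
  shows "measure cantor (\<Union>j\<in>{n<..}. E j) \<le> (1/2) ^ n"
proof -
  have eq: "(\<Union>j\<in>{n<..}. E j) = (\<Union>j. E (j + Suc n))"
  proof (intro equalityI subsetI)
    fix Y assume "Y \<in> (\<Union>j\<in>{n<..}. E j)"
    then obtain j where "n < j" "Y \<in> E j" by blast
    then show "Y \<in> (\<Union>j. E (j + Suc n))" by (intro UN_I[of "j - Suc n"]) auto
  qed auto
  have summable: "summable (\<lambda>j. measure cantor (E (j + Suc n)))"
    by (rule summable_comparison_test'[OF sums_summable[OF sums_half_powers_tail[of n]]])
       (simp only: real_norm_def abs_of_nonneg[OF measure_nonneg] assms(2))
  have "measure cantor (\<Union>j. E (j + Suc n)) \<le> (\<Sum>j. measure cantor (E (j + Suc n)))"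
    using assms(1) summable by (intro cantor.finite_measure_subadditive_countably) auto
  also have "\<dots> \<le> (\<Sum>j. (1/2) ^ (j + Suc n))"
    by (intro suminf_le assms(2) summable sums_summable[OF sums_half_powers_tail])
  also have "\<dots> = (1/2) ^ n" using sums_half_powers_tail by (rule sums_unique[symmetric])
  finally show ?thesis unfolding eq .
qed

text \<open>
  An effective first Borel-Cantelli lemma. The tails \<open>U i\<close> of the sequence of events
  \<open>segment X (g j) \<in> R\<close> are effectively open of measure at most \<open>(1/2) ^ i\<close>, and their measure is
  computable because cutting the union off at \<open>j = n\<close> changes it by at most the measure of
  \<open>U n\<close>, that is by at most \<open>(1/2) ^ n\<close>.
\<close>
lemma schnorr_random_finitely_often:
  assumes X: "schnorr_random X"
    and R: "computable_set R"
    and g: "computable_fun 1 (\<lambda>xs. g (xs ! 0))"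
    and small: "\<And>j. string_prob (g j) (\<lambda>\<sigma>. \<sigma> \<in> R) \<le> (1/2) ^ j"
  shows "finite {j. segment X (g j) \<in> R}"
proof (rule ccontr)
  assume inf: "infinite {j. segment X (g j) \<in> R}"
  define E where "E j = {Y. segment Y (g j) \<in> R}" for j
  define U where "U i = (\<Union>j\<in>{i<..}. E j)" for i
  define W where "W i = {\<sigma>. \<exists>j. i < j \<and> length \<sigma> = g j \<and> \<sigma> \<in> R}" for i
  (* A length that is at least g j for all j \<le> n. *)
  define L where "L n = (\<Sum>j<Suc n. g j)" for n
  define hit where "hit i n \<sigma> \<longleftrightarrow> (\<exists>j<Suc n. i < j \<and> take (g j) \<sigma> \<in> R)" for i n \<sigma>
  define p where "p i n = card {\<sigma>. length \<sigma> = L n \<and> hit i n \<sigma>}" for i n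
  have g_rule: "computable_fun m (\<lambda>xs. g (a xs))" if "computable_fun m a" for m a
    using computable_fun_apply1[OF g that] .
  have E_sets: "E j \<in> sets cantor" for j unfolding E_def by (rule sets_segment)
  have E_le: "measure cantor (E j) \<le> (1/2) ^ j" for j
    unfolding E_def measure_segment[of "\<lambda>\<sigma>. \<sigma> \<in> R"] by (rule small)
  have U_cyl: "U i = cyl (W i)" for i
    unfolding U_def W_def E_def cyl_def by auto
  have "uniformly_ce W"
    by (rule uniformly_ceI[where P = "\<lambda>i \<sigma> j. i < j \<and> length \<sigma> = g j \<and> \<sigma> \<in> R"])
       (auto simp: W_def intro!: computability_rules computable_fun_length g_rule
          decidable_rel_mem[OF R])
  then have eff: "uniformly_effectively_open U"
    unfolding uniformly_effectively_open_def using U_cyl by blast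
  have g_le: "g j \<le> L n" if "j < Suc n" for j n
    unfolding L_def using that by (intro member_le_sum) auto
  have real: "uniformly_computable_real (\<lambda>i. measure cantor (U i))"
  proof (rule uniformly_computable_realI[where p = p and L = "\<lambda>_. L"])
    show L: "computable_fun 2 (\<lambda>xs. L (xs ! 1))"
      unfolding L_def by (intro computability_rules g_rule) auto
    show "computable_fun 2 (\<lambda>xs. p (xs ! 0) (xs ! 1))"
      unfolding p_def hit_def
      by (intro computable_fun_card_strings L computability_rules g_rule
          decidable_rel_mem[OF R] computable_str_take computable_str_decode) auto
    fix i n
    have hit: "{Y. hit i n (segment Y (L n))} = (\<Union>j\<in>{i<..} \<inter> {..n}. E j)"
      unfolding hit_def E_def using g_le by (auto simp: take_segment less_Suc_eq_le)
    have split: "U i \<subseteq> {Y. hit i n (segment Y (L n))} \<union> U n"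
      unfolding hit unfolding U_def by force
    have sub: "{Y. hit i n (segment Y (L n))} \<subseteq> U i"
      unfolding hit unfolding U_def by auto
    have sets: "{Y. hit i n (segment Y (L n))} \<in> sets cantor" by (rule sets_segment)
    have U_sets: "U k \<in> sets cantor" for k unfolding U_def using E_sets by auto
    have "measure cantor (U i) \<le> measure cantor {Y. hit i n (segment Y (L n))} + measure cantor (U n)"
      using cantor.finite_measure_mono[OF split sets.Un[OF sets U_sets]]
        measure_Un_le[OF sets U_sets[of n]] by (rule order_trans)
    moreover have "measure cantor {Y. hit i n (segment Y (L n))} \<le> measure cantor (U i)"
      using cantor.finite_measure_mono[OF sub] U_sets by blast
    moreover have "measure cantor (U n) \<le> (1/2) ^ n"
      unfolding U_def by (rule measure_tail_events_le[OF E_sets E_le])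
    moreover have "measure cantor {Y. hit i n (segment Y (L n))} = real (p i n) / 2 ^ L n"
      unfolding measure_segment string_prob_def p_def ..
    ultimately show "\<bar>measure cantor (U i) - real (p i n) / 2 ^ L n\<bar> \<le> (1/2) ^ n" by linarith
  qed
  have "schnorr_test U"
    unfolding schnorr_test_def using eff real measure_tail_events_le[OF E_sets E_le]
    by (auto simp: U_def)
  moreover have "X \<in> U i" for i
    using inf unfolding U_def E_def infinite_nat_iff_unbounded by auto
  ultimately show False using X unfolding schnorr_random_def by blast
qed

section \<open>Counting blocks\<close>
definition block_count :: "bool list set \<Rightarrow> bool list \<Rightarrow> nat" where
  "block_count S \<sigma> = length (THE \<tau>s. parses S \<sigma> \<tau>s)"

lemma length_phi: "length (phi S l \<sigma>) = block_count S \<sigma>"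
  by (simp add: phi_def block_count_def)

lemma block_count_parses: "parses S \<sigma> \<tau>s \<Longrightarrow> block_count S \<sigma> = length \<tau>s"
  unfolding block_count_def by (metis parses_unique theI)

lemma block_count_append:
  assumes "[] \<notin> terminal S" "\<tau> \<in> terminal S"
  shows "block_count S (\<tau> @ \<rho>) = Suc (block_count S \<rho>)"
proof -
  obtain \<tau>s where \<tau>s: "parses S \<rho> \<tau>s" using parses_exists[OF assms(1)] by blast
  then have "parses S (\<tau> @ \<rho>) (\<tau> # \<tau>s)" using assms(2) by (auto simp: parses_def)
  then show ?thesis using \<tau>s by (simp add: block_count_parses)
qed

lemma block_count_eq_0:
  assumes "\<And>\<tau>. \<tau> \<in> terminal S \<Longrightarrow> \<not> prefix \<tau> \<sigma>"
  shows "block_count S \<sigma> = 0"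
proof -
  have "parses S \<sigma> []" using assms by (auto simp: parses_def)
  from block_count_parses[OF this] show ?thesis by simp
qed

text \<open>
  A left-to-right scan for computing the block decomposition: the state after \<open>p\<close> bits is the
  position at which the block that is currently being read began. A block ends after bit \<open>q\<close>
  exactly if the state becomes \<open>Suc q\<close>, so the number of blocks can be read off from the
  sequence of states, each of which is a single number.
\<close>
definition block_start :: "bool list set \<Rightarrow> bool list \<Rightarrow> nat \<Rightarrow> nat" where
  "block_start S \<sigma> p =
     rec_nat 0 (\<lambda>q s. if drop s (take (Suc q) \<sigma>) \<in> terminal S then Suc q else s) p"

lemma block_start_Suc:
  "block_start S \<sigma> (Suc q) =
     (if drop (block_start S \<sigma> q) (take (Suc q) \<sigma>) \<in> terminal S then Suc q else block_start S \<sigma> q)"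
  by (simp add: block_start_def)

lemma parses_block_start:
  assumes nonempty: "[] \<notin> terminal S"
  shows "p \<le> length \<sigma> \<Longrightarrow> \<exists>\<tau>s. parses S (take p \<sigma>) \<tau>s \<and> length (concat \<tau>s) = block_start S \<sigma> p \<and>
      length \<tau>s = (\<Sum>q<p. of_bool (block_start S \<sigma> (Suc q) = Suc q))"
proof (induction p)
  case 0
  have "parses S [] []" using nonempty by (auto simp: parses_def)
  then show ?case by (intro exI[of _ "[]"]) (simp add: block_start_def)
next
  case (Suc p)
  then obtain \<tau>s where \<tau>s: "parses S (take p \<sigma>) \<tau>s" "length (concat \<tau>s) = block_start S \<sigma> p"
      "length \<tau>s = (\<Sum>q<p. of_bool (block_start S \<sigma> (Suc q) = Suc q))" by auto
  then obtain \<rho> where \<rho>: "take p \<sigma> = concat \<tau>s @ \<rho>" "\<And>\<tau>. \<tau> \<in> terminal S \<Longrightarrow> \<not> prefix \<tau> \<rho>"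
      and sub: "set \<tau>s \<subseteq> terminal S" unfolding parses_def by blast
  define \<rho>' where "\<rho>' = \<rho> @ [\<sigma> ! p]"
  have take: "take (Suc p) \<sigma> = concat \<tau>s @ \<rho>'"
    using Suc.prems \<rho>(1) by (simp add: take_Suc_conv_app_nth \<rho>'_def)
  have drop: "drop (block_start S \<sigma> p) (take (Suc p) \<sigma>) = \<rho>'"
    unfolding take \<tau>s(2)[symmetric] by simp
  have "length (concat \<tau>s) \<le> p"
    using arg_cong[OF \<rho>(1), of length] Suc.prems by simp
  then have start_le: "block_start S \<sigma> p \<le> p" using \<tau>s(2) by simp
  show ?case
  proof (cases "\<rho>' \<in> terminal S")
    case True
    have start: "block_start S \<sigma> (Suc p) = Suc p" unfolding block_start_Suc drop using True by simp
    have "parses S (take (Suc p) \<sigma>) (\<tau>s @ [\<rho>'])"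
      unfolding parses_def take using True sub nonempty by auto
    moreover have "length (concat (\<tau>s @ [\<rho>'])) = Suc p"
      using arg_cong[OF take, of length] Suc.prems by simp
    ultimately show ?thesis using start \<tau>s(3) by (intro exI[of _ "\<tau>s @ [\<rho>']"]) simp
  next
    case False
    have start: "block_start S \<sigma> (Suc p) = block_start S \<sigma> p"
      unfolding block_start_Suc drop using False by simp
    have "\<not> prefix \<tau> \<rho>'" if "\<tau> \<in> terminal S" for \<tau>
      using \<rho>(2)[OF that] False that unfolding \<rho>'_def prefix_snoc by auto
    then have "parses S (take (Suc p) \<sigma>) \<tau>s" unfolding parses_def take using sub by auto
    then show ?thesis using start \<tau>s(2,3) start_le by (intro exI[of _ \<tau>s]) simp
  qed
qed

lemma block_count_take:
  assumes "[] \<notin> terminal S" "p \<le> length \<sigma>"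
  shows "block_count S (take p \<sigma>) = (\<Sum>q<p. of_bool (block_start S \<sigma> (Suc q) = Suc q))"
  using parses_block_start[OF assms] block_count_parses by metis

lemma block_count_eq_sum:
  assumes "[] \<notin> terminal S"
  shows "block_count S \<sigma> = (\<Sum>q<length \<sigma>. of_bool (block_start S \<sigma> (Suc q) = Suc q))"
  using block_count_take[OF assms, of "length \<sigma>" \<sigma>] by simp

lemma block_count_take_le:
  assumes "[] \<notin> terminal S"
  shows "block_count S (take p \<sigma>) \<le> block_count S \<sigma>"
proof (cases "p \<le> length \<sigma>")
  case True
  show ?thesis
    unfolding block_count_take[OF assms True] unfolding block_count_eq_sum[OF assms, of \<sigma>]
    using True by (intro sum_mono2) auto
qed simp

lemma block_count_le_length:
  assumes "[] \<notin> terminal S"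
  shows "block_count S \<sigma> \<le> length \<sigma>"
  unfolding block_count_eq_sum[OF assms]
  by (rule order_trans[OF sum_bounded_above[where K = 1]]) auto

lemma computable_fun_block_count:
  assumes D: "computable_set (terminal S)" and "[] \<notin> terminal S" and s: "computable_str n s"
  shows "computable_fun n (\<lambda>xs. block_count S (s xs))"
proof -
  have start: "computable_fun 2 (\<lambda>xs. block_start S (decode (xs ! 0)) (xs ! 1))"
    unfolding block_start_def
    by (intro computable_fun_rec computability_rules decidable_rel_mem[OF D] computable_str_drop
        computable_str_take computable_str_decode) auto
  have "computable_fun 1 (\<lambda>xs. \<Sum>q<length (decode (xs ! 0)).
          of_bool (block_start S (decode (xs ! 0)) (Suc q) = Suc q))"
    by (intro computability_rules computable_fun_length computable_str_decode
        computable_fun_apply2[OF start]) auto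
  then have "computable_fun 1 (\<lambda>xs. block_count S (decode (xs ! 0)))"
    unfolding block_count_eq_sum[OF assms(2)] .
  from computable_fun_apply1[OF this s] show ?thesis by simp
qed

section \<open>Averages over strings of a given length\<close>
definition string_avg :: "nat \<Rightarrow> (bool list \<Rightarrow> real) \<Rightarrow> real" where
  "string_avg n f = (\<Sum>\<sigma> | length \<sigma> = n. f \<sigma>) / 2 ^ n"

lemma card_length_eq: "card {\<sigma> :: bool list. length \<sigma> = n} = 2 ^ n"
  using card_lists_length_eq[of "UNIV :: bool set" n] by simp

lemma finite_length [simp]: "finite {\<sigma> :: bool list. length \<sigma> = n}"
  using finite_length_eq[of n "\<lambda>_. True"] by simp

lemma string_prob_eq_avg: "string_prob n P = string_avg n (\<lambda>\<sigma>. of_bool (P \<sigma>))"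
  unfolding string_prob_def string_avg_def
  by (subst sum_of_bool_eq) (auto intro!: arg_cong[where f = card])

lemma string_avg_const [simp]: "string_avg n (\<lambda>_. c) = c"
  by (simp add: string_avg_def card_length_eq)

lemma string_avg_add: "string_avg n (\<lambda>\<sigma>. f \<sigma> + g \<sigma>) = string_avg n f + string_avg n g"
  by (simp add: string_avg_def sum.distrib add_divide_distrib)

lemma string_avg_cmult: "string_avg n (\<lambda>\<sigma>. c * f \<sigma>) = c * string_avg n f"
  by (simp add: string_avg_def sum_distrib_left[symmetric])

lemma string_avg_mono:
  "(\<And>\<sigma>. length \<sigma> = n \<Longrightarrow> f \<sigma> \<le> g \<sigma>) \<Longrightarrow> string_avg n f \<le> string_avg n g"
  unfolding string_avg_def by (intro divide_right_mono sum_mono) auto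

lemma string_avg_sum: "string_avg n (\<lambda>\<sigma>. \<Sum>i\<in>I. f i \<sigma>) = (\<Sum>i\<in>I. string_avg n (f i))"
  unfolding string_avg_def by (subst sum.swap) (simp add: sum_divide_distrib)

lemma string_avg_cong:
  "(\<And>\<sigma>. length \<sigma> = n \<Longrightarrow> f \<sigma> = g \<sigma>) \<Longrightarrow> string_avg n f = string_avg n g"
  unfolding string_avg_def by (intro arg_cong2[where f = "(/)"] sum.cong) auto

lemma string_avg_product:
  assumes "i \<le> n"
  shows "string_avg n (\<lambda>\<sigma>. f (take i \<sigma>) * g (drop i \<sigma>)) = string_avg i f * string_avg (n - i) g"
proof -
  have "(\<Sum>\<sigma> | length \<sigma> = n. f (take i \<sigma>) * g (drop i \<sigma>)) =
        (\<Sum>(\<tau>, \<rho>) \<in> {\<tau>. length \<tau> = i} \<times> {\<rho>. length \<rho> = n - i}. f \<tau> * g \<rho>)"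
    using assms
    by (intro sum.reindex_bij_witness[of _ "\<lambda>(\<tau>, \<rho>). \<tau> @ \<rho>" "\<lambda>\<sigma>. (take i \<sigma>, drop i \<sigma>)"]) auto
  also have "\<dots> = (\<Sum>\<tau> | length \<tau> = i. f \<tau>) * (\<Sum>\<rho> | length \<rho> = n - i. g \<rho>)"
    by (simp add: sum.cartesian_product[symmetric] sum_product)
  finally show ?thesis
    using assms unfolding string_avg_def by (simp add: power_add[symmetric])
qed

definition leaf_prob :: "bool list set \<Rightarrow> nat \<Rightarrow> real" where
  "leaf_prob S i = string_prob i (\<lambda>\<sigma>. \<sigma> \<in> terminal S)"

lemma leaf_prob_nonneg: "0 \<le> leaf_prob S i"
  by (simp add: leaf_prob_def string_prob_def)

text \<open>
  The renewal equation. A string of length \<open>n\<close> either has no terminal node as a prefix, and then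
  contributes nothing, or factors uniquely into a terminal node of some length \<open>i\<close> and an
  arbitrary string of length \<open>n - i\<close>. Kraft's inequality, the distribution of the number of
  blocks and its mean are obtained from it by choosing \<open>f\<close>.
\<close>
lemma string_avg_first_block:
  assumes none: "\<And>\<sigma>. (\<And>\<tau>. \<tau> \<in> terminal S \<Longrightarrow> \<not> prefix \<tau> \<sigma>) \<Longrightarrow> f \<sigma> = 0"
    and block: "\<And>\<tau> \<rho>. \<tau> \<in> terminal S \<Longrightarrow> f (\<tau> @ \<rho>) = h \<rho>"
  shows "string_avg n f = (\<Sum>i\<le>n. leaf_prob S i * string_avg (n - i) h)"
proof -
  have pointwise: "f \<sigma> = (\<Sum>i\<le>n. of_bool (take i \<sigma> \<in> terminal S) * h (drop i \<sigma>))"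
    if n: "length \<sigma> = n" for \<sigma>
  proof (cases "\<exists>\<tau>\<in>terminal S. prefix \<tau> \<sigma>")
    case True
    then obtain \<tau> \<rho> where \<tau>: "\<tau> \<in> terminal S" "\<sigma> = \<tau> @ \<rho>" by (auto elim: prefixE)
    have uniq: "i = length \<tau>" if "i \<le> n" "take i \<sigma> \<in> terminal S" for i
    proof -
      have "take i \<sigma> = \<tau>"
        using terminal_prefix_eq[OF that(2) \<tau>(1) take_is_prefix, of ] \<tau>(2) by simp
      then show ?thesis using that(1) n by auto
    qed
    have "(\<Sum>i\<le>n. of_bool (take i \<sigma> \<in> terminal S) * h (drop i \<sigma>)) =
          (\<Sum>i\<in>{length \<tau>}. of_bool (take i \<sigma> \<in> terminal S) * h (drop i \<sigma>))"
      using n \<tau>(2) uniq by (intro sum.mono_neutral_right) auto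
    then show ?thesis using \<tau> block by simp
  next
    case False
    then have "take i \<sigma> \<notin> terminal S" for i using take_is_prefix by blast
    then show ?thesis using none False by simp
  qed
  have "string_avg n f =
      (\<Sum>i\<le>n. string_avg n (\<lambda>\<sigma>. of_bool (take i \<sigma> \<in> terminal S) * h (drop i \<sigma>)))"
    unfolding string_avg_sum[symmetric] by (rule string_avg_cong[OF pointwise])
  also have "\<dots> = (\<Sum>i\<le>n. leaf_prob S i * string_avg (n - i) h)"
  proof (intro sum.cong refl)
    fix i assume "i \<in> {..n}"
    then show "string_avg n (\<lambda>\<sigma>. of_bool (take i \<sigma> \<in> terminal S) * h (drop i \<sigma>)) =
        leaf_prob S i * string_avg (n - i) h"
      using string_avg_product[of i n "\<lambda>\<sigma>. of_bool (\<sigma> \<in> terminal S)" h]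
      by (simp add: leaf_prob_def string_prob_eq_avg)
  qed
  finally show ?thesis .
qed

lemma kraft_inequality: "(\<Sum>i\<le>n. leaf_prob S i) \<le> 1"
proof -
  have "(\<Sum>i\<le>n. leaf_prob S i) = string_avg n (\<lambda>\<sigma>. of_bool (\<exists>\<tau>\<in>terminal S. prefix \<tau> \<sigma>))"
    by (subst string_avg_first_block[where h = "\<lambda>_. 1"]) (auto simp: prefix_def)
  also have "\<dots> \<le> string_avg n (\<lambda>_. 1)" by (rule string_avg_mono) simp
  finally show ?thesis by simp
qed

lemma prob_block_count_Suc:
  assumes "[] \<notin> terminal S"
  shows "string_prob n (\<lambda>\<sigma>. Suc k \<le> block_count S \<sigma>) =
    (\<Sum>i\<le>n. leaf_prob S i * string_prob (n - i) (\<lambda>\<sigma>. k \<le> block_count S \<sigma>))"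
  unfolding string_prob_eq_avg
  by (rule string_avg_first_block) (simp_all add: block_count_eq_0 block_count_append[OF assms])

lemma avg_block_count:
  assumes "[] \<notin> terminal S"
  shows "string_avg n (\<lambda>\<sigma>. block_count S \<sigma>) =
    (\<Sum>i\<le>n. leaf_prob S i * (string_avg (n - i) (\<lambda>\<sigma>. block_count S \<sigma>) + 1))"
proof -
  have "string_avg n (\<lambda>\<sigma>. block_count S \<sigma>) =
    (\<Sum>i\<le>n. leaf_prob S i * string_avg (n - i) (\<lambda>\<sigma>. real (block_count S \<sigma>) + 1))"
    by (rule string_avg_first_block) (simp_all add: block_count_eq_0 block_count_append[OF assms])
  then show ?thesis by (simp add: string_avg_add)
qed

section \<open>Tail bounds for the number of blocks\<close>
lemma string_prob_le_1: "string_prob n P \<le> 1"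
  using string_avg_mono[of n "\<lambda>\<sigma>. of_bool (P \<sigma>)" "\<lambda>_. 1"] by (simp add: string_prob_eq_avg)

text \<open>
  Chernoff's bound: there are \<open>k\<close> blocks in \<open>n\<close> bits iff the total length \<open>T\<close> of the first
  \<open>k\<close> blocks is at most \<open>n\<close>, and then \<open>x ^ T \<ge> x ^ n\<close>, while the expectation of \<open>x ^ T\<close> is the
  \<open>k\<close>-th power of the generating function of the block length at \<open>x\<close>. The renewal equation turns
  this into an induction on \<open>k\<close>.
\<close>
lemma prob_block_count_ge_le:
  fixes x \<psi> :: real
  assumes nonempty: "[] \<notin> terminal S"
    and x: "0 < x" "x \<le> 1"
    and \<psi>: "\<And>n. (\<Sum>i\<le>n. leaf_prob S i * x ^ i) \<le> \<psi>"
  shows "string_prob n (\<lambda>\<sigma>. k \<le> block_count S \<sigma>) \<le> \<psi> ^ k / x ^ n"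
proof (induction k arbitrary: n)
  case 0
  have "1 \<le> 1 / x ^ n" using x by (simp add: power_le_one)
  then show ?case using order_trans[OF string_prob_le_1] by simp
next
  case (Suc k)
  have "0 \<le> (\<Sum>i\<le>0. leaf_prob S i * x ^ i)"
    using x leaf_prob_nonneg by (intro sum_nonneg mult_nonneg_nonneg) auto
  with \<psi>[of 0] have \<psi>_nonneg: "0 \<le> \<psi>" by linarith
  have "string_prob n (\<lambda>\<sigma>. Suc k \<le> block_count S \<sigma>) =
      (\<Sum>i\<le>n. leaf_prob S i * string_prob (n - i) (\<lambda>\<sigma>. k \<le> block_count S \<sigma>))"
    by (rule prob_block_count_Suc[OF nonempty])
  also have "\<dots> \<le> (\<Sum>i\<le>n. leaf_prob S i * (\<psi> ^ k / x ^ (n - i)))"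
    by (intro sum_mono mult_left_mono Suc.IH leaf_prob_nonneg)
  also have "\<dots> = (\<Sum>i\<le>n. leaf_prob S i * x ^ i * (\<psi> ^ k / x ^ n))"
    using x by (intro sum.cong refl) (simp add: power_diff)
  also have "\<dots> = (\<Sum>i\<le>n. leaf_prob S i * x ^ i) * (\<psi> ^ k / x ^ n)"
    by (rule sum_distrib_right[symmetric])
  also have "\<dots> \<le> \<psi> * (\<psi> ^ k / x ^ n)"
    using \<psi> \<psi>_nonneg x by (intro mult_right_mono) auto
  finally show ?case by simp
qed

text \<open>
  Beyond depth \<open>m\<close>, the powers of \<open>x\<close> are estimated by \<open>1\<close> and the mass of the leaves by Kraft's
  inequality. What remains on the right is a polynomial in \<open>x\<close>, whose derivative at \<open>1\<close> is the
  average running time truncated at depth \<open>m\<close>, even if the average running time is infinite.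
\<close>
lemma leaf_generating_sum_le:
  assumes x: "0 \<le> x" "x \<le> 1"
  shows "(\<Sum>i\<le>n. leaf_prob S i * x ^ i) \<le> 1 - (\<Sum>i\<le>m. leaf_prob S i * (1 - x ^ i))"
proof -
  have pow: "x ^ i \<le> 1" for i using x by (simp add: power_le_one)
  have "(\<Sum>i\<le>n. leaf_prob S i * x ^ i) \<le> (\<Sum>i\<le>max n m. leaf_prob S i * x ^ i)"
    using x leaf_prob_nonneg by (intro sum_mono2) auto
  also have "\<dots> = (\<Sum>i\<le>max n m. leaf_prob S i) - (\<Sum>i\<le>max n m. leaf_prob S i * (1 - x ^ i))"
    by (simp add: algebra_simps flip: sum_subtractf)
  finally have "(\<Sum>i\<le>n. leaf_prob S i * x ^ i) \<le> \<dots>" .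
  moreover have "(\<Sum>i\<le>m. leaf_prob S i * (1 - x ^ i)) \<le> (\<Sum>i\<le>max n m. leaf_prob S i * (1 - x ^ i))"
    using pow leaf_prob_nonneg by (intro sum_mono2) auto
  ultimately show ?thesis using kraft_inequality[of S "max n m"] by linarith
qed

text \<open>
  At \<open>x = 1\<close> both sides of the inequality are equal to \<open>1\<close>, and the left one has the larger
  derivative; so it is the smaller one just below \<open>1\<close>.
\<close>
lemma exists_contraction_point:
  assumes s: "s < (\<Sum>i\<le>m. real i * leaf_prob S i)"
  obtains x where "0 < x" "x < 1"
    "1 - (\<Sum>i\<le>m. leaf_prob S i * (1 - x ^ i)) < x powr s"
proof -
  define f where "f x = x powr s - (1 - (\<Sum>i\<le>m. leaf_prob S i * (1 - x ^ i)))" for x :: real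
  have "(f has_real_derivative s - (\<Sum>i\<le>m. leaf_prob S i * real i)) (at 1)"
    unfolding f_def by (auto intro!: derivative_eq_intros sum.cong simp: sum_negf[symmetric])
  moreover have "s - (\<Sum>i\<le>m. leaf_prob S i * real i) < 0" using s by (simp add: mult.commute)
  ultimately obtain d where d: "d > 0" "\<And>h. 0 < h \<Longrightarrow> h < d \<Longrightarrow> f 1 < f (1 - h)"
    using DERIV_neg_dec_left by blast
  define h where "h = min d 1 / 2"
  have "f 1 < f (1 - h)" using d(1) by (intro d(2)) (auto simp: h_def)
  moreover have "f 1 = 0" by (simp add: f_def)
  moreover have "0 < h" "h < 1" using d(1) by (auto simp: h_def)
  ultimately show ?thesis by (intro that[of "1 - h"]) (auto simp: f_def)
qed

text \<open>
  For \<open>s\<close> between \<open>1 / t\<close> and the truncated average running time there is \<open>x < 1\<close> at which the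
  generating function of the block length is at most \<open>x powr s\<close>. With at least \<open>t n\<close> blocks,
  Chernoff's bound becomes \<open>x powr (s t n) / x ^ n\<close>, which decays since \<open>s t > 1\<close>.
\<close>
lemma exponential_upper_tail:
  assumes nonempty: "[] \<notin> terminal S"
    and t: "0 < t" "1 / t < (\<Sum>i\<le>m. real i * leaf_prob S i)"
  obtains r where "0 < r" "r < 1"
    "\<And>n. string_prob n (\<lambda>\<sigma>. t * real n \<le> real (block_count S \<sigma>)) \<le> r ^ n"
proof -
  obtain s where s: "1 / t < s" "s < (\<Sum>i\<le>m. real i * leaf_prob S i)"
    using t(2) dense by blast
  have "0 < 1 / t" using t(1) by simp
  then have st: "0 < s" "1 < s * t" using s(1) t(1) by (linarith, simp add: field_simps)
  obtain x where x: "0 < x" "x < 1" "1 - (\<Sum>i\<le>m. leaf_prob S i * (1 - x ^ i)) < x powr s"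
    using exists_contraction_point[OF s(2)] .
  have \<psi>: "(\<Sum>i\<le>n. leaf_prob S i * x ^ i) \<le> x powr s" for n
    using leaf_generating_sum_le[where S = S and m = m, of x n] x by linarith
  define r where "r = x powr (s * t - 1)"
  show thesis
  proof (rule that[of r])
    show "0 < r" using x by (simp add: r_def)
    have "x powr (s * t - 1) < 1 powr (s * t - 1)"
      using x st by (intro powr_less_mono2) auto
    then show "r < 1" by (simp add: r_def)
    fix n
    define k where "k = nat \<lceil>t * real n\<rceil>"
    have k: "t * real n \<le> real k" unfolding k_def by (rule real_nat_ceiling_ge)
    have iff: "t * real n \<le> real b \<longleftrightarrow> k \<le> b" for b :: nat
      unfolding k_def by (simp add: nat_le_iff ceiling_le_iff)
    have "string_prob n (\<lambda>\<sigma>. t * real n \<le> real (block_count S \<sigma>)) \<le> (x powr s) ^ k / x ^ n"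
      unfolding iff using nonempty x \<psi> by (intro prob_block_count_ge_le) auto
    also have "(x powr s) ^ k = x powr (s * real k)"
      using x by (simp add: powr_powr flip: powr_realpow)
    also have "\<dots> \<le> x powr (s * (t * real n))"
      using x k st by (intro powr_mono') auto
    also have "x powr (s * (t * real n)) / x ^ n = r ^ n"
      using x unfolding r_def by (simp add: powr_powr powr_diff[symmetric] algebra_simps flip: powr_realpow)
    finally show "string_prob n (\<lambda>\<sigma>. t * real n \<le> real (block_count S \<sigma>)) \<le> r ^ n"
      using x by (simp add: divide_right_mono)
  qed
qed

text \<open>
  A form of Wald's identity: the first \<open>block_count S \<sigma> + 1\<close> blocks together have length greater
  than \<open>n\<close>, and on average they have length \<open>E\<close> each. In the induction, the terms with \<open>i > n\<close> may
  be added to the renewal equation because \<open>real n - real i\<close> is negative for them.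
\<close>
lemma avg_block_count_ge:
  assumes nonempty: "[] \<notin> terminal S"
    and total: "leaf_prob S sums 1"
    and mean: "(\<lambda>i. real i * leaf_prob S i) sums E" and E: "0 < E"
  shows "real n / E \<le> string_avg n (\<lambda>\<sigma>. real (block_count S \<sigma>)) + 1"
proof (induction n rule: less_induct)
  case (less n)
  define f where "f i = leaf_prob S i * ((real n - real i) / E)" for i
  have zero: "leaf_prob S 0 = 0" using nonempty by (simp add: leaf_prob_def string_prob_def)
  have "(\<lambda>i. (real n * leaf_prob S i - real i * leaf_prob S i) / E) sums ((real n * 1 - E) / E)"
    by (intro sums_divide sums_diff sums_mult total mean)
  then have f: "f sums (real n / E - 1)"
    using E by (simp add: f_def[abs_def] algebra_simps diff_divide_distrib)
  have "(\<Sum>i\<le>n. - f i) \<le> (\<Sum>i. - f i)"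
  proof (rule sum_le_suminf)
    show "summable (\<lambda>i. - f i)" using f by (intro summable_minus) (rule sums_summable)
    show "0 \<le> - f i" if "i \<in> - {..n}" for i
      unfolding f_def using that E leaf_prob_nonneg[of S i]
      by (simp add: mult_nonneg_nonpos divide_nonpos_pos)
  qed auto
  also have "(\<Sum>i. - f i) = - (real n / E - 1)" using sums_unique[OF sums_minus[OF f]] by simp
  finally have "real n / E - 1 \<le> (\<Sum>i\<le>n. f i)" by (simp add: sum_negf)
  also have "\<dots> \<le> (\<Sum>i\<le>n. leaf_prob S i * (string_avg (n - i) (\<lambda>\<sigma>. real (block_count S \<sigma>)) + 1))"
  proof (rule sum_mono)
    fix i assume i: "i \<in> {..n}"
    show "f i \<le> leaf_prob S i * (string_avg (n - i) (\<lambda>\<sigma>. real (block_count S \<sigma>)) + 1)"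
    proof (cases "i = 0")
      case False
      then have "real (n - i) / E \<le> string_avg (n - i) (\<lambda>\<sigma>. real (block_count S \<sigma>)) + 1"
        using i by (intro less.IH) auto
      then show ?thesis
        unfolding f_def using i by (intro mult_left_mono leaf_prob_nonneg) (auto simp: of_nat_diff)
    qed (simp add: f_def zero)
  qed
  also have "\<dots> = string_avg n (\<lambda>\<sigma>. real (block_count S \<sigma>))"
    by (rule avg_block_count[OF nonempty, symmetric])
  finally show ?case by linarith
qed

text \<open>
  The block rate has mean about \<open>1 / E\<close> or more, and by \<open>exponential_upper_tail\<close> it hardly ever
  exceeds \<open>1 / E + \<eta>\<close>. It cannot then be below \<open>t\<close> with a probability bounded away from \<open>0\<close>, as
  nothing could compensate for the loss.
\<close>
lemma lower_tail_tendsto_0: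
  assumes nonempty: "[] \<notin> terminal S"
    and total: "leaf_prob S sums 1"
    and mean: "(\<lambda>i. real i * leaf_prob S i) sums E" and E: "0 < E"
    and t: "t < 1 / E" and \<epsilon>: "0 < \<epsilon>"
  shows "eventually (\<lambda>n. string_prob n (\<lambda>\<sigma>. real (block_count S \<sigma>) < t * real n) \<le> \<epsilon>) sequentially"
proof -
  define \<gamma> where "\<gamma> = 1 / E - t"
  define \<eta> where "\<eta> = \<epsilon> * \<gamma> / 2"
  define t' where "t' = 1 / E + \<eta>"
  have pos: "0 < \<gamma>" "0 < \<eta>" using t \<epsilon> by (auto simp: \<gamma>_def \<eta>_def)
  have t': "0 < t'" using E pos by (simp add: t'_def add_pos_pos)
  have "1 / t' < E" using E pos t' unfolding t'_def by (simp add: field_simps)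
  moreover have "(\<lambda>m. \<Sum>i\<le>m. real i * leaf_prob S i) \<longlonglongrightarrow> E" using mean by (simp add: sums_def_le)
  ultimately have "eventually (\<lambda>m. 1 / t' < (\<Sum>i\<le>m. real i * leaf_prob S i)) sequentially"
    by (rule order_tendstoD(1)[rotated])
  then obtain m where "1 / t' < (\<Sum>i\<le>m. real i * leaf_prob S i)"
    using eventually_happens by force
  then obtain r where r: "0 < r" "r < 1"
    "\<And>n. string_prob n (\<lambda>\<sigma>. t' * real n \<le> real (block_count S \<sigma>)) \<le> r ^ n"
    using exponential_upper_tail[OF nonempty t'] by blast
  have "(\<lambda>n. 1 / real n + r ^ n) \<longlonglongrightarrow> 0 + 0"
    using r by (intro tendsto_add lim_1_over_n LIMSEQ_realpow_zero) auto
  then have "eventually (\<lambda>n. 1 / real n + r ^ n < \<eta>) sequentially"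
    using pos by (intro order_tendstoD(2)[where a = \<eta>]) auto
  moreover have "eventually (\<lambda>n. 0 < n) sequentially" by (rule eventually_gt_at_top)
  ultimately show ?thesis
  proof eventually_elim
    case (elim n)
    let ?b = "\<lambda>\<sigma>. real (block_count S \<sigma>)"
    let ?p = "string_prob n (\<lambda>\<sigma>. ?b \<sigma> < t * real n)"
    let ?u = "string_prob n (\<lambda>\<sigma>. t' * real n \<le> ?b \<sigma>)"
    have tt': "t' - t = \<gamma> + \<eta>" by (simp add: t'_def \<gamma>_def)
    have "real n / E - 1 \<le> string_avg n ?b"
      using avg_block_count_ge[OF nonempty total mean E, of n] by linarith
    (* Bound the number of blocks by t * n, t' * n or n, according to the range of the block rate. *)
    also have "\<dots> \<le> string_avg n (\<lambda>\<sigma>. t' * real n +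
        (- ((t' - t) * real n) * of_bool (?b \<sigma> < t * real n) + real n * of_bool (t' * real n \<le> ?b \<sigma>)))"
    proof (rule string_avg_mono)
      fix \<sigma> :: "bool list" assume n: "length \<sigma> = n"
      have "?b \<sigma> \<le> real n" using block_count_le_length[OF nonempty, of \<sigma>] n by simp
      moreover have "0 \<le> t' * real n" using t' by simp
      moreover have "t * real n \<le> t' * real n" using tt' pos by (intro mult_right_mono) auto
      ultimately show "?b \<sigma> \<le> t' * real n +
        (- ((t' - t) * real n) * of_bool (?b \<sigma> < t * real n) + real n * of_bool (t' * real n \<le> ?b \<sigma>))"
        by (auto simp: algebra_simps of_bool_def)
    qed
    also have "\<dots> = t' * real n + (- ((t' - t) * real n) * ?p + real n * ?u)"
      by (simp only: string_avg_add string_avg_cmult string_avg_const string_prob_eq_avg)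
    finally have "(t' - t) * ?p * real n \<le> (t' - 1 / E + 1 / real n + ?u) * real n"
      using elim(2) by (simp add: algebra_simps)
    then have "(t' - t) * ?p \<le> t' - 1 / E + 1 / real n + ?u"
      using elim(2) by (simp add: mult_le_cancel_right)
    then have "(\<gamma> + \<eta>) * ?p \<le> \<eta> + (1 / real n + r ^ n)"
      using r(3)[of n] unfolding tt' by (simp add: t'_def)
    moreover have "\<gamma> * ?p \<le> (\<gamma> + \<eta>) * ?p"
      using pos by (intro mult_right_mono) (auto simp: string_prob_def)
    ultimately have "\<gamma> * ?p \<le> 2 * \<eta>" using elim(1) by linarith
    also have "\<dots> = \<gamma> * \<epsilon>" by (simp add: \<eta>_def)
    finally show ?case using pos by (simp add: mult_le_cancel_left)
  qed
qed

section \<open>The block rate of a Schnorr random sequence\<close>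

text \<open>
  The unordered sum over all terminal nodes, grouped by label in the definition of a DDG-tree, is
  regrouped by length. Kraft's inequality guarantees that it converges.
\<close>
lemma leaf_prob_sums_1:
  assumes "ddg_tree A S l"
  shows "leaf_prob S sums 1"
proof -
  let ?D = "terminal S"
  let ?w = "\<lambda>\<tau> :: bool list. (1/2::real) ^ length \<tau>"
  have level: "(\<Sum>\<tau>\<in>{\<tau>\<in>?D. length \<tau> = i}. ?w \<tau>) = leaf_prob S i" for i
    unfolding leaf_prob_def string_prob_def
    by (simp add: power_divide conj_commute)
  have fin: "finite {\<tau>\<in>?D. length \<tau> = i}" for i
    using finite_length_eq[of i "\<lambda>\<tau>. \<tau> \<in> ?D"] by (simp add: conj_commute)
  have levels: "(\<Sum>\<tau>\<in>{\<tau>\<in>?D. length \<tau> \<le> n}. ?w \<tau>) = (\<Sum>i\<le>n. leaf_prob S i)" for n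
  proof -
    have "{\<tau>\<in>?D. length \<tau> \<le> n} = (\<Union>i\<in>{..n}. {\<tau>\<in>?D. length \<tau> = i})" by auto
    then show ?thesis
      by (simp only: level[symmetric]) (intro sum.UNION_disjoint, auto simp: fin)
  qed
  have fin_le: "finite {\<tau>\<in>?D. length \<tau> \<le> n}" for n
  proof -
    have "{\<tau>\<in>?D. length \<tau> \<le> n} = (\<Union>i\<in>{..n}. {\<tau>\<in>?D. length \<tau> = i})" by auto
    then show ?thesis using fin by simp
  qed
  have summable: "?w summable_on ?D"
  proof (rule nonneg_bdd_above_summable_on)
    show "bdd_above (sum ?w ` {F. F \<subseteq> ?D \<and> finite F})"
    proof (rule bdd_aboveI2)
      fix F assume "F \<in> {F. F \<subseteq> ?D \<and> finite F}"
      then have F: "F \<subseteq> ?D" "finite F" by auto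
      (* Inserting 0 gives the maximum a value for empty F. *)
      have "F \<subseteq> {\<tau>\<in>?D. length \<tau> \<le> Max (insert 0 (length ` F))}" using F by auto
      then have "sum ?w F \<le> (\<Sum>i\<le>Max (insert 0 (length ` F)). leaf_prob S i)"
        unfolding levels[symmetric] by (intro sum_mono2 fin_le) auto
      then show "sum ?w F \<le> 1" using kraft_inequality by (rule order_trans)
    qed
  qed simp
  have A: "finite A" "l ` ?D \<subseteq> A" "(\<Sum>a\<in>A. label_prob S l a) = 1"
    using assms by (auto simp: ddg_tree_def)
  have "(\<Sum>a\<in>A. label_prob S l a) = infsum ?w (\<Union>a\<in>A. {\<tau>\<in>?D. l \<tau> = a})"
    unfolding label_prob_def
    by (intro sum_infsum A summable_on_subset_banach[OF summable]) auto
  also have "(\<Union>a\<in>A. {\<tau>\<in>?D. l \<tau> = a}) = ?D" using A(2) by auto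
  finally have "infsum ?w ?D = 1" using A(3) by simp
  then have "(?w has_sum 1) ?D" using has_sum_infsum[OF summable] by simp
  moreover have "filterlim (\<lambda>n. {\<tau>\<in>?D. length \<tau> \<le> n}) (finite_subsets_at_top ?D) sequentially"
    unfolding filterlim_finite_subsets_at_top
  proof (intro allI impI)
    fix F assume F: "finite F \<and> F \<subseteq> ?D"
    have "eventually (\<lambda>n. Max (insert 0 (length ` F)) \<le> n) sequentially" by (rule eventually_ge_at_top)
    then show "eventually (\<lambda>n. finite {\<tau>\<in>?D. length \<tau> \<le> n} \<and> F \<subseteq> {\<tau>\<in>?D. length \<tau> \<le> n} \<and>
        {\<tau>\<in>?D. length \<tau> \<le> n} \<subseteq> ?D) sequentially"
    proof eventually_elim
      case (elim n)
      then show ?case using F fin_le by auto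
    qed
  qed
  ultimately have "(\<lambda>n. \<Sum>i\<le>n. leaf_prob S i) \<longlonglongrightarrow> 1"
    unfolding has_sum_def levels[symmetric] by (rule filterlim_compose)
  then show ?thesis by (simp add: sums_def_le)
qed

lemma avg_rt_eq: "avg_rt S = (\<Sum>i. ennreal (real i * leaf_prob S i))"
proof -
  have "cyl (terminal S \<inter> {\<tau>. length \<tau> = i}) = {X. segment X i \<in> terminal S}" for i
    by (auto simp: cyl_def)
  then show ?thesis
    unfolding avg_rt_def leaf_prob_def
    by (simp add: cantor.emeasure_eq_measure measure_segment[of "\<lambda>\<sigma>. \<sigma> \<in> terminal S"]
        ennreal_mult' flip: ennreal_of_nat_eq_real_of_nat)
qed

lemma decidable_block_ratio:
  assumes D: "computable_set (terminal S)" and nonempty: "[] \<notin> terminal S"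
  shows "computable_set {\<sigma>. a * length \<sigma> \<le> b * block_count S \<sigma>}"
    and "computable_set {\<sigma>. b * block_count S \<sigma> < a * length \<sigma>}"
proof -
  have \<sigma>: "computable_str 1 (\<lambda>xs. decode (xs ! 0))"
    by (intro computable_str_decode computable_fun_nth) simp
  have len: "computable_fun 1 (\<lambda>xs. a * length (decode (xs ! 0)))"
    by (intro computable_fun_mult computable_fun_const computable_fun_length \<sigma>)
  have count: "computable_fun 1 (\<lambda>xs. b * block_count S (decode (xs ! 0)))"
    by (intro computable_fun_mult computable_fun_const computable_fun_block_count[OF D nonempty \<sigma>])
  show "computable_set {\<sigma>. a * length \<sigma> \<le> b * block_count S \<sigma>}"
    by (rule computable_setI) (unfold mem_Collect_eq, rule decidable_rel_le[OF len count])
  show "computable_set {\<sigma>. b * block_count S \<sigma> < a * length \<sigma>}"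
    by (rule computable_setI) (unfold mem_Collect_eq, rule decidable_rel_less[OF count len])
qed

text \<open>
  The exponential tail bound holds with a rate \<open>r\<close> that need not be computable. It suffices to
  choose a natural number \<open>c\<close> with \<open>r ^ c < 1 / 2\<close>: the test looks only at lengths that are multiples
  of \<open>c\<close>, and between two of them the number of blocks is controlled by monotonicity. The bound
  \<open>t\<close> is rational so that the test is decidable.
\<close>
lemma limsup_ratio_le:
  assumes X: "schnorr_random X" and D: "computable_set (terminal S)" and nonempty: "[] \<notin> terminal S"
    and ab: "0 < a" "0 < b"
    and mean: "real b / real a < (\<Sum>i\<le>m. real i * leaf_prob S i)"
  shows "OI S l X \<le> ennreal (real a / real b)"
proof -
  define t where "t = real a / real b"
  have t: "0 < t" "1 / t < (\<Sum>i\<le>m. real i * leaf_prob S i)" using ab mean by (auto simp: t_def)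
  obtain r where r: "0 < r" "r < 1"
    "\<And>n. string_prob n (\<lambda>\<sigma>. t * real n \<le> real (block_count S \<sigma>)) \<le> r ^ n"
    using exponential_upper_tail[OF nonempty t] by blast
  obtain c where c: "r ^ c < 1 / 2" using real_arch_pow_inv[of "1/2" r] r by auto
  then have c_pos: "0 < c" by (cases c) auto
  define R where "R = {\<sigma>. a * length \<sigma> \<le> b * block_count S \<sigma>}"
  have R: "\<sigma> \<in> R \<longleftrightarrow> t * real (length \<sigma>) \<le> real (block_count S \<sigma>)" for \<sigma>
  proof -
    have "\<sigma> \<in> R \<longleftrightarrow> real (a * length \<sigma>) \<le> real (b * block_count S \<sigma>)"
      unfolding R_def of_nat_le_iff by simp
    then show ?thesis using ab by (simp add: t_def field_simps)
  qed
  have "finite {j. segment X (c * j) \<in> R}"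
  proof (rule schnorr_random_finitely_often[OF X])
    show "computable_set R" unfolding R_def by (rule decidable_block_ratio[OF D nonempty])
    show "computable_fun 1 (\<lambda>xs. c * xs ! 0)" by (intro computability_rules) auto
    fix j
    have "string_prob (c * j) (\<lambda>\<sigma>. \<sigma> \<in> R) =
        string_prob (c * j) (\<lambda>\<sigma>. t * real (c * j) \<le> real (block_count S \<sigma>))"
      unfolding string_prob_eq_avg by (rule string_avg_cong) (simp add: R)
    also have "\<dots> \<le> (r ^ c) ^ j" using r(3)[of "c * j"] by (simp add: power_mult)
    also have "\<dots> \<le> (1/2) ^ j" using c r by (intro power_mono) auto
    finally show "string_prob (c * j) (\<lambda>\<sigma>. \<sigma> \<in> R) \<le> (1/2) ^ j" .
  qed
  then obtain J where J: "\<And>j. segment X (c * j) \<in> R \<Longrightarrow> j < J"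
    using finite_nat_set_iff_bounded by auto
  have ev: "eventually (\<lambda>n. ennreal (real (block_count S (segment X n)) / real n) \<le>
      ennreal (t + t * real c / real n)) sequentially"
    using eventually_ge_at_top[of "Suc (c * J)"]
  proof eventually_elim
    case (elim n)
    (* c * j is the least multiple of c that exceeds n. *)
    define j where "j = Suc (n div c)"
    have "c * J div c \<le> n div c" using elim by (intro div_le_mono) simp
    then have "J \<le> j" using c_pos by (simp add: j_def)
    have n_le: "n \<le> c * j" "c * j \<le> n + c"
      using c_pos by (simp_all add: j_def dividend_less_times_div less_imp_le)
    have "block_count S (segment X n) \<le> block_count S (segment X (c * j))"
      using block_count_take_le[OF nonempty, of n "segment X (c * j)"] n_le
      by (simp add: take_segment)
    moreover have "segment X (c * j) \<notin> R" using J[of j] \<open>J \<le> j\<close> by auto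
    then have "real (block_count S (segment X (c * j))) \<le> t * real (c * j)" by (simp add: R)
    moreover have "t * real (c * j) \<le> t * real (n + c)"
      using t n_le by (intro mult_left_mono of_nat_mono) auto
    ultimately have "real (block_count S (segment X n)) \<le> t * real (n + c)" by linarith
    then have "real (block_count S (segment X n)) / real n \<le> t * real (n + c) / real n"
      by (rule divide_right_mono) simp
    also have "\<dots> = t + t * real c / real n" using elim by (simp add: field_simps)
    finally show ?case by (rule ennreal_leI)
  qed
  have "(\<lambda>n. t + t * real c * (1 / real n)) \<longlonglongrightarrow> t + t * real c * 0"
    by (intro tendsto_intros lim_1_over_n)
  then have "(\<lambda>n. ennreal (t + t * real c / real n)) \<longlonglongrightarrow> ennreal t"
    by (intro tendsto_ennrealI) simp
  then have "limsup (\<lambda>n. ennreal (t + t * real c / real n)) = ennreal t"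
    by (intro lim_imp_Limsup) auto
  then show ?thesis
    using Limsup_mono[OF ev] unfolding OI_def length_phi t_def by simp
qed

text \<open>
  The lower tail tends to \<open>0\<close>, possibly without a computable rate of convergence. For a limit
  superior it is enough to find some lengths \<open>h j\<close>, tending to infinity, at which the lower tail is
  at most \<open>(1/2) ^ j\<close>, and these are found by search because the probabilities are computable
  dyadic rationals.
\<close>
lemma limsup_ratio_ge:
  assumes X: "schnorr_random X" and D: "computable_set (terminal S)" and nonempty: "[] \<notin> terminal S"
    and total: "leaf_prob S sums 1"
    and mean: "(\<lambda>i. real i * leaf_prob S i) sums E" and E: "0 < E"
    and b: "0 < b" and less: "real a / real b < 1 / E"
  shows "ennreal (real a / real b) \<le> OI S l X"
proof (rule ccontr)
  assume "\<not> ?thesis"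
  then have "OI S l X < ennreal (real a / real b)" by simp
  then have ev: "eventually (\<lambda>n. ennreal (real (block_count S (segment X n)) / real n) <
      ennreal (real a / real b)) sequentially"
    unfolding OI_def length_phi by (rule Limsup_lessD)
  define t where "t = real a / real b"
  define R where "R = {\<sigma>. b * block_count S \<sigma> < a * length \<sigma>}"
  have R: "\<sigma> \<in> R \<longleftrightarrow> real (block_count S \<sigma>) < t * real (length \<sigma>)" for \<sigma>
  proof -
    have "\<sigma> \<in> R \<longleftrightarrow> real (b * block_count S \<sigma>) < real (a * length \<sigma>)"
      unfolding R_def of_nat_less_iff by simp
    then show ?thesis using b by (simp add: t_def field_simps)
  qed
  have R_comp: "computable_set R" unfolding R_def by (rule decidable_block_ratio[OF D nonempty])
  define good where "good j n \<longleftrightarrow> j \<le> n \<and> card {\<sigma>. length \<sigma> = n \<and> \<sigma> \<in> R} * 2 ^ j \<le> 2 ^ n" for j n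
  define h where "h j = (LEAST n. good j n)" for j
  have good_prob: "good j n \<longleftrightarrow> j \<le> n \<and> string_prob n (\<lambda>\<sigma>. \<sigma> \<in> R) \<le> (1/2) ^ j" for j n
  proof -
    have "card {\<sigma>. length \<sigma> = n \<and> \<sigma> \<in> R} * 2 ^ j \<le> 2 ^ n \<longleftrightarrow>
        real (card {\<sigma>. length \<sigma> = n \<and> \<sigma> \<in> R} * 2 ^ j) \<le> real (2 ^ n)"
      unfolding of_nat_le_iff ..
    also have "\<dots> \<longleftrightarrow> string_prob n (\<lambda>\<sigma>. \<sigma> \<in> R) \<le> (1/2) ^ j"
      by (simp add: string_prob_def power_divide field_simps)
    finally show ?thesis unfolding good_def by simp
  qed
  have ex: "\<exists>n. good j n" for j
  proof -
    have "eventually (\<lambda>n. string_prob n (\<lambda>\<sigma>. real (block_count S \<sigma>) < t * real n) \<le> (1/2) ^ j)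
        sequentially"
      using less unfolding t_def by (intro lower_tail_tendsto_0[OF nonempty total mean E]) auto
    then have "eventually (\<lambda>n. j \<le> n \<and>
        string_prob n (\<lambda>\<sigma>. real (block_count S \<sigma>) < t * real n) \<le> (1/2) ^ j) sequentially"
      by (intro eventually_conj eventually_ge_at_top)
    then obtain n where n: "j \<le> n"
      "string_prob n (\<lambda>\<sigma>. real (block_count S \<sigma>) < t * real n) \<le> (1/2) ^ j"
      using eventually_happens by force
    have "string_prob n (\<lambda>\<sigma>. \<sigma> \<in> R) = string_prob n (\<lambda>\<sigma>. real (block_count S \<sigma>) < t * real n)"
      unfolding string_prob_eq_avg by (rule string_avg_cong) (simp add: R)
    then show ?thesis using n good_prob by auto
  qed
  have good_h: "good j (h j)" for j unfolding h_def using ex by (rule LeastI_ex)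
  have "finite {j. segment X (h j) \<in> R}"
  proof (rule schnorr_random_finitely_often[OF X R_comp])
    show "computable_fun 1 (\<lambda>xs. h (xs ! 0))"
      unfolding h_def
    proof (rule computable_fun_Least)
      show "decidable_rel (Suc 1) (\<lambda>ys. good (tl ys ! 0) (hd ys))"
        unfolding good_def
        by (intro computability_rules computable_fun_card_strings decidable_rel_mem[OF R_comp]
            computable_str_decode) auto
    qed (rule ex)
    show "string_prob (h j) (\<lambda>\<sigma>. \<sigma> \<in> R) \<le> (1/2) ^ j" for j using good_h good_prob by blast
  qed
  then obtain J where J: "\<And>j. segment X (h j) \<in> R \<Longrightarrow> j < J"
    using finite_nat_set_iff_bounded by auto
  obtain N where N: "\<And>n. N \<le> n \<Longrightarrow> ennreal (real (block_count S (segment X n)) / real n) < ennreal t"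
    using ev unfolding eventually_sequentially t_def by blast
  define j where "j = Suc (max J N)"
  have "j \<le> h j" using good_h good_def by blast
  then have n: "0 < h j" "N \<le> h j" by (auto simp: j_def)
  have "segment X (h j) \<notin> R" using J[of j] by (auto simp: j_def)
  then have "t * real (h j) \<le> real (block_count S (segment X (h j)))" by (simp add: R)
  then have "t \<le> real (block_count S (segment X (h j))) / real (h j)"
    using n by (simp add: field_simps)
  then have "ennreal t \<le> ennreal (real (block_count S (segment X (h j))) / real (h j))"
    by (rule ennreal_leI)
  then show False using N[OF n(2)] by (meson leD)
qed

lemma ennreal_rational_between:
  fixes x y :: ennreal
  assumes "x < y"
  obtains a b :: nat where "0 < a" "0 < b" "x < ennreal (real a / real b)" "ennreal (real a / real b) < y"
proof -
  obtain q :: rat where q: "x < ennreal (real_of_rat q)" "ennreal (real_of_rat q) < y"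
    using ennreal_rat_dense[OF assms] by blast
  have pos: "0 < real_of_rat q" using q(1) by (rule contrapos_pp) (simp add: ennreal_neg)
  obtain a b :: nat where ab: "b \<noteq> 0" "\<bar>real_of_rat q\<bar> = real a / real b"
    using Rats_abs_nat_div_natE[of "real_of_rat q"] by (metis Rats_of_rat)
  then have eq: "real_of_rat q = real a / real b" using pos by simp
  then have "0 < a" using pos by (cases a) auto
  then show ?thesis using that[of a b] ab(1) q eq by simp
qed

theorem theorem24:
  fixes X :: "nat \<Rightarrow> bool"
    and A :: "'a set"
    and S :: "bool list set"
    and l :: "bool list \<Rightarrow> 'a"
  assumes "schnorr_random X"
    and "ddg_tree A S l"
    and "[] \<notin> terminal S"
    and "computable_ddg_tree A S l"
    and "minimal_ddg_tree S l"
  shows "OI S l X = 1 / avg_rt S"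
proof -
  have D: "computable_set (terminal S)" using assms(4) by (simp add: computable_ddg_tree_def)
  have total: "leaf_prob S sums 1" by (rule leaf_prob_sums_1[OF assms(2)])
  have nonneg: "0 \<le> real i * leaf_prob S i" for i using leaf_prob_nonneg by simp
  have upper: "OI S l X \<le> ennreal (real a / real b)"
    if ab: "0 < a" "0 < b" and less: "1 / avg_rt S < ennreal (real a / real b)" for a b
  proof -
    have "ennreal (real b / real a) < avg_rt S"
    proof (cases "avg_rt S")
      case (real E)
      have "0 < E"
      proof (rule ccontr)
        assume "\<not> 0 < E"
        then have "avg_rt S = 0" using real by simp
        then show False using less by (simp add: divide_ennreal_def)
      qed
      then have "1 / E < real a / real b"
        using less ab unfolding real(2) by (simp add: divide_ennreal ennreal_less_iff flip: ennreal_1)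
      then show ?thesis
        unfolding real(2) using ab \<open>0 < E\<close> by (simp add: ennreal_less_iff field_simps)
    qed simp
    also have "avg_rt S = (SUP m. \<Sum>i<m. ennreal (real i * leaf_prob S i))"
      unfolding avg_rt_eq by (rule suminf_eq_SUP)
    finally obtain m where "ennreal (real b / real a) < (\<Sum>i<m. ennreal (real i * leaf_prob S i))"
      unfolding less_SUP_iff by blast
    also have "\<dots> \<le> (\<Sum>i\<le>m. ennreal (real i * leaf_prob S i))" by (intro sum_mono2) auto
    also have "\<dots> = ennreal (\<Sum>i\<le>m. real i * leaf_prob S i)" using nonneg by (rule sum_ennreal)
    finally have "real b / real a < (\<Sum>i\<le>m. real i * leaf_prob S i)"
      by (simp add: ennreal_less_iff)
    then show ?thesis by (rule limsup_ratio_le[OF assms(1) D assms(3) ab])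
  qed
  have lower: "ennreal (real a / real b) \<le> OI S l X"
    if ab: "0 < a" "0 < b" and less: "ennreal (real a / real b) < 1 / avg_rt S" for a b
  proof -
    have "avg_rt S \<noteq> \<top>" using less by auto
    then have summable: "summable (\<lambda>i. real i * leaf_prob S i)"
      unfolding avg_rt_eq using nonneg by (intro summable_suminf_not_top)
    define E where "E = (\<Sum>i. real i * leaf_prob S i)"
    have mean: "(\<lambda>i. real i * leaf_prob S i) sums E"
      unfolding E_def using summable by (rule summable_sums)
    have avg: "avg_rt S = ennreal E"
      unfolding avg_rt_eq E_def using nonneg summable by (rule suminf_ennreal2)
    have "leaf_prob S 0 = 0" using assms(3) by (simp add: leaf_prob_def string_prob_def)
    then have "leaf_prob S i \<le> real i * leaf_prob S i" for i
      using leaf_prob_nonneg[of S i] by (cases i) (auto simp: algebra_simps)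
    then have "1 \<le> E" using total mean by (rule sums_le)
    then have "real a / real b < 1 / E"
      using less ab unfolding avg by (simp add: divide_ennreal ennreal_less_iff flip: ennreal_1)
    then show ?thesis
      using \<open>1 \<le> E\<close> ab by (intro limsup_ratio_ge[OF assms(1) D assms(3) total mean]) auto
  qed
  have "OI S l X \<le> 1 / avg_rt S"
  proof (rule ccontr)
    assume "\<not> ?thesis"
    then have "1 / avg_rt S < OI S l X" by simp
    then obtain a b :: nat where "0 < a" "0 < b" "1 / avg_rt S < ennreal (real a / real b)"
      "ennreal (real a / real b) < OI S l X" by (rule ennreal_rational_between)
    then show False using upper[of a b] by simp
  qed
  moreover have "1 / avg_rt S \<le> OI S l X"
  proof (rule ccontr)
    assume "\<not> ?thesis"
    then have "OI S l X < 1 / avg_rt S" by simp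
    then obtain a b :: nat where "0 < a" "0 < b" "OI S l X < ennreal (real a / real b)"
      "ennreal (real a / real b) < 1 / avg_rt S" by (rule ennreal_rational_between)
    then show False using lower[of a b] by simp
  qed
  ultimately show ?thesis by (rule antisym)
qed

end
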